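(* Let $A$ be an operator algebra (possibly not approximately unital), let $B$ be a unital $C^*$-algebra containing $A$, and let $q$ be a projection in $(A^1)^{**}$ such that $q = u(a)$ is the peak of an element $a$ in the closed unit ball of $A^1$. Suppose that $b \in A$ is such that $|b|$ commutes with $a$, and suppose also that $q b^* b q \leq q d q$ for some invertible positive $d \in B$ which commutes with $a$. Then there exists an element $x \in A$ with $x^* x \leq d$ and $xq = bq$.
   Context: An operator algebra is a norm closed algebra $A$ of operators on a Hilbert space, not assumed to have an identity; it is approximately unital if it has a contractive approximate identity. The unitization $A^1$ is identified with $A + \mathbb{C} 1_B \subset B$. Biduals carry their Arens products; $(A^1)^{**}$ is identified with the weak* closure $(A^1)^{\perp\perp}$ of $A^1$ in the von Neumann algebra $B^{**}$, in which the products and inequalities involving $q$ are taken. $|b| = (b^*b)^{1/2} \in B$. A projection means an orthogonal (self-adjoint) projection. For $a$ in the closed unit ball of $A^1$, $u(a)$ is the weak* limit of $a(a^*a)^n$ as $n \to \infty$; if $u(a)$ is a projection, it also equals the weak* limit $\lim_n a^n$, and one says that $a$ peaks at $u(a)$ (and $u(a)$ is the peak of $a$). *)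

theory Defs
  imports "HOL-Analysis.Analysis"
begin

section \<open>Complex normed spaces and unital C*-algebras\<close>

class complex_normed_vector = real_normed_vector +
  fixes scaleC :: "complex \<Rightarrow> 'a \<Rightarrow> 'a"  (infixr \<open>*\<^sub>C\<close> 75)
  assumes scaleC_add_right: "c *\<^sub>C (x + y) = c *\<^sub>C x + c *\<^sub>C y"
    and scaleC_add_left: "(c + d) *\<^sub>C x = c *\<^sub>C x + d *\<^sub>C x"
    and scaleC_scaleC: "c *\<^sub>C (d *\<^sub>C x) = (c * d) *\<^sub>C x"
    and scaleR_scaleC: "r *\<^sub>R x = complex_of_real r *\<^sub>C x"
    and norm_scaleC: "norm (c *\<^sub>C x) = cmod c * norm x"

class cstar_algebra = complex_normed_vector + real_normed_algebra_1 + banach +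
  fixes star :: "'a \<Rightarrow> 'a"
  assumes mult_scaleC_left: "(c *\<^sub>C x) * y = c *\<^sub>C (x * y)"
    and mult_scaleC_right: "x * (c *\<^sub>C y) = c *\<^sub>C (x * y)"
    and star_add: "star (x + y) = star x + star y"
    and star_scaleC: "star (c *\<^sub>C x) = cnj c *\<^sub>C star x"
    and star_mult: "star (x * y) = star y * star x"
    and star_star: "star (star x) = x"
    and norm_star_mult_self: "norm (star x * x) = (norm x)\<^sup>2"

lemma norm_star: "norm (star x) = norm (x :: 'a :: cstar_algebra)"
proof -
  have le: "norm y \<le> norm (star y)" for y :: 'a
  proof (cases "y = 0")
    case False
    have "norm y * norm y \<le> norm (star y) * norm y"
      using norm_mult_ineq[of "star y" y] by (simp add: norm_star_mult_self power2_eq_square)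
    then show ?thesis using False by simp
  qed simp
  show ?thesis using le[of x] le[of "star x"] by (simp add: star_star)
qed

definition cstar_positive :: "'a :: cstar_algebra \<Rightarrow> bool" where
  "cstar_positive x \<longleftrightarrow> (\<exists>c. x = star c * c)"

definition cstar_le :: "'a :: cstar_algebra \<Rightarrow> 'a \<Rightarrow> bool"  (infix \<open>\<preceq>\<close> 50) where
  "x \<preceq> y \<longleftrightarrow> cstar_positive (y - x)"

text \<open>A positive element has exactly one positive square root.\<close>

definition cstar_sqrt :: "'a :: cstar_algebra \<Rightarrow> 'a" where
  "cstar_sqrt x = (THE p. cstar_positive p \<and> p * p = x)"

definition cstar_abs :: "'a :: cstar_algebra \<Rightarrow> 'a" where
  "cstar_abs b = cstar_sqrt (star b * b)"

section \<open>Operator algebras inside a C*-algebra\<close>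

text \<open>The ambient C*-algebra is a type, so an operator algebra contained in it is a norm closed
  complex subalgebra. It need not contain the unit of the ambient algebra, nor any unit or
  approximate unit of its own.\<close>

definition operator_algebra :: "'a :: cstar_algebra set \<Rightarrow> bool" where
  "operator_algebra A \<longleftrightarrow> closed A \<and> 0 \<in> A \<and>
     (\<forall>x\<in>A. \<forall>y\<in>A. x + y \<in> A \<and> x * y \<in> A) \<and> (\<forall>c. \<forall>x\<in>A. c *\<^sub>C x \<in> A)"

definition unitization :: "'a :: cstar_algebra set \<Rightarrow> 'a set" where
  "unitization A = {x + c *\<^sub>C 1 |x c. x \<in> A}"

section \<open>Dual spaces\<close>

definition bounded_clinear :: "('a :: complex_normed_vector \<Rightarrow> complex) \<Rightarrow> bool" where
  "bounded_clinear f \<longleftrightarrow> bounded_linear f \<and> (\<forall>c x. f (c *\<^sub>C x) = c * f x)"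

lemma bounded_clinearI:
  assumes "\<And>x y. f (x + y) = f x + f y" "\<And>c x. f (c *\<^sub>C x) = c * f x"
    and "\<And>x. cmod (f x) \<le> K * norm x"
  shows "bounded_clinear f"
  unfolding bounded_clinear_def
proof
  show "bounded_linear f"
    by (rule bounded_linear_intro[where K = K])
      (use assms in \<open>simp_all add: scaleR_scaleC scaleR_conv_of_real mult.commute\<close>)
qed (use assms in simp)

typedef (overloaded) 'a cdual = "{f :: 'a :: complex_normed_vector \<Rightarrow> complex. bounded_clinear f}"
  morphisms cdual_apply Abs_cdual
  by (rule exI[of _ "\<lambda>_. 0"]) (simp add: bounded_clinear_def)

setup_lifting type_definition_cdual

instantiation cdual :: (complex_normed_vector) complex_normed_vector
begin

lift_definition zero_cdual :: "'a cdual" is "\<lambda>_. 0"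
  by (simp add: bounded_clinear_def)

lift_definition plus_cdual :: "'a cdual \<Rightarrow> 'a cdual \<Rightarrow> 'a cdual" is "\<lambda>f g x. f x + g x"
  by (auto simp: bounded_clinear_def bounded_linear_add algebra_simps)

lift_definition minus_cdual :: "'a cdual \<Rightarrow> 'a cdual \<Rightarrow> 'a cdual" is "\<lambda>f g x. f x - g x"
  by (auto simp: bounded_clinear_def bounded_linear_sub algebra_simps)

lift_definition uminus_cdual :: "'a cdual \<Rightarrow> 'a cdual" is "\<lambda>f x. - f x"
  by (auto simp: bounded_clinear_def bounded_linear_minus)

lift_definition scaleR_cdual :: "real \<Rightarrow> 'a cdual \<Rightarrow> 'a cdual" is "\<lambda>r f x. r *\<^sub>R f x"
  by (auto simp: bounded_clinear_def bounded_linear_const_scaleR)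

lift_definition scaleC_cdual :: "complex \<Rightarrow> 'a cdual \<Rightarrow> 'a cdual" is "\<lambda>c f x. c * f x"
  by (auto simp: bounded_clinear_def bounded_linear_const_mult)

lift_definition norm_cdual :: "'a cdual \<Rightarrow> real" is onorm .

definition dist_cdual :: "'a cdual \<Rightarrow> 'a cdual \<Rightarrow> real" where
  "dist_cdual f g = norm (f - g)"

definition sgn_cdual :: "'a cdual \<Rightarrow> 'a cdual" where
  "sgn_cdual f = inverse (norm f) *\<^sub>R f"

definition uniformity_cdual :: "('a cdual \<times> 'a cdual) filter" where
  "uniformity_cdual = (INF e\<in>{0<..}. principal {(f, g). dist f g < e})"

definition open_cdual :: "'a cdual set \<Rightarrow> bool" where
  "open_cdual U \<longleftrightarrow> (\<forall>f\<in>U. \<forall>\<^sub>F (f', g) in uniformity. f' = f \<longrightarrow> g \<in> U)"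

instance
proof
  fix f g h :: "'a cdual" and r s :: real and c d :: complex and U :: "'a cdual set"
  show "f + g + h = f + (g + h)" by transfer auto
  show "f + g = g + f" by transfer auto
  show "0 + f = f" by transfer auto
  show "- f + f = 0" by transfer auto
  show "f - g = f + - g" by transfer auto
  show "r *\<^sub>R (f + g) = r *\<^sub>R f + r *\<^sub>R g" by transfer (auto simp: algebra_simps)
  show "(r + s) *\<^sub>R f = r *\<^sub>R f + s *\<^sub>R f" by transfer (auto simp: algebra_simps)
  show "r *\<^sub>R s *\<^sub>R f = (r * s) *\<^sub>R f" by transfer auto
  show "1 *\<^sub>R f = f" by transfer auto
  show "dist f g = norm (f - g)" by (rule dist_cdual_def)
  show "sgn f = inverse (norm f) *\<^sub>R f" by (rule sgn_cdual_def)
  show "uniformity = (INF e\<in>{0<..}. principal {(f, g :: 'a cdual). dist f g < e})"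
    by (rule uniformity_cdual_def)
  show "open U \<longleftrightarrow> (\<forall>f\<in>U. \<forall>\<^sub>F (f', g) in uniformity. f' = f \<longrightarrow> g \<in> U)"
    by (rule open_cdual_def)
  show "norm f = 0 \<longleftrightarrow> f = 0"
    by transfer (auto simp: bounded_clinear_def onorm_eq_0)
  show "norm (f + g) \<le> norm f + norm g"
    by transfer (simp add: bounded_clinear_def onorm_triangle)
  show "norm (r *\<^sub>R f) = \<bar>r\<bar> * norm f"
    by transfer (simp add: bounded_clinear_def onorm_scaleR)
  show "c *\<^sub>C (f + g) = c *\<^sub>C f + c *\<^sub>C g" by transfer (auto simp: algebra_simps)
  show "(c + d) *\<^sub>C f = c *\<^sub>C f + d *\<^sub>C f" by transfer (auto simp: algebra_simps)
  show "c *\<^sub>C d *\<^sub>C f = (c * d) *\<^sub>C f" by transfer auto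
  show "r *\<^sub>R f = complex_of_real r *\<^sub>C f" by transfer (auto simp: scaleR_conv_of_real)
  show "norm (c *\<^sub>C f) = cmod c * norm f"
  proof transfer
    fix c and f :: "'a \<Rightarrow> complex" assume "bounded_clinear f"
    then have "onorm (\<lambda>x. cmod c *\<^sub>R f x) = cmod c * onorm f"
      by (simp add: bounded_clinear_def onorm_scaleR)
    then show "onorm (\<lambda>x. c * f x) = cmod c * onorm f"
      by (simp add: onorm_def norm_mult)
  qed
qed

end

lemma cdual_apply_add: "cdual_apply f (x + y) = cdual_apply f x + cdual_apply f y"
  and cdual_apply_scaleC: "cdual_apply f (c *\<^sub>C x) = c * cdual_apply f x"
  and cdual_apply_bound: "cmod (cdual_apply f x) \<le> norm f * norm x"
  by (transfer; simp add: bounded_clinear_def linear_add bounded_linear.linear onorm)+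

lemma norm_cdual_le:
  assumes "0 \<le> K" "\<And>x. cmod (cdual_apply f x) \<le> K * norm x"
  shows "norm f \<le> K"
  using assms by transfer (simp add: onorm_bound)

text \<open>The weak* topology is the topology of pointwise convergence on the predual.\<close>

definition weak_star_topology :: "'a :: complex_normed_vector cdual topology" where
  "weak_star_topology =
     pullback_topology UNIV cdual_apply (product_topology (\<lambda>_. euclidean) UNIV)"

section \<open>The bidual of a C*-algebra\<close>

type_synonym 'a bidual = "'a cdual cdual"

lift_definition bidual_embed :: "'a :: complex_normed_vector \<Rightarrow> 'a bidual" is
  "\<lambda>x f. cdual_apply f x"
proof -
  fix x :: 'a
  show "bounded_clinear (\<lambda>f. cdual_apply f x)"
  proof (rule bounded_clinearI[where K = "norm x"])
    show "cmod (cdual_apply f x) \<le> norm x * norm f" for f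
      using cdual_apply_bound[of f x] by (simp add: mult.commute)
  qed (simp_all add: plus_cdual.rep_eq scaleC_cdual.rep_eq)
qed

text \<open>The first Arens product, in the usual three steps: \<open>(f \<cdot> x)(y) = f (x y)\<close>,
  \<open>(\<Psi> \<cdot> f)(x) = \<Psi> (f \<cdot> x)\<close> and \<open>(\<Phi> \<Psi>)(f) = \<Phi> (\<Psi> \<cdot> f)\<close>.
  On the bidual of a C*-algebra it coincides with the second Arens product.\<close>

lift_definition dual_act :: "'a :: cstar_algebra cdual \<Rightarrow> 'a \<Rightarrow> 'a cdual" is
  "\<lambda>f x y. cdual_apply f (x * y)"
proof -
  fix f :: "'a cdual" and x :: 'a
  show "bounded_clinear (\<lambda>y. cdual_apply f (x * y))"
  proof (rule bounded_clinearI[where K = "norm f * norm x"])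
    fix y :: 'a
    have "cmod (cdual_apply f (x * y)) \<le> norm f * norm (x * y)"
      by (rule cdual_apply_bound)
    also have "\<dots> \<le> norm f * (norm x * norm y)"
      by (intro mult_left_mono norm_mult_ineq norm_ge_zero)
    finally show "cmod (cdual_apply f (x * y)) \<le> norm f * norm x * norm y"
      by (simp add: mult.assoc)
  qed (simp_all add: distrib_left cdual_apply_add mult_scaleC_right cdual_apply_scaleC)
qed

lemma norm_dual_act: "norm (dual_act f x) \<le> norm f * norm x"
proof (rule norm_cdual_le)
  fix y
  have "cmod (cdual_apply f (x * y)) \<le> norm f * norm (x * y)"
    by (rule cdual_apply_bound)
  also have "\<dots> \<le> norm f * (norm x * norm y)"
    by (intro mult_left_mono norm_mult_ineq norm_ge_zero)
  finally show "cmod (cdual_apply (dual_act f x) y) \<le> norm f * norm x * norm y"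
    by (simp add: mult.assoc dual_act.rep_eq)
qed simp

lemma dual_act_linear:
  "dual_act f (x + y) = dual_act f x + dual_act f y"
  "dual_act f (c *\<^sub>C x) = c *\<^sub>C dual_act f x"
  "dual_act (f + g) x = dual_act f x + dual_act g x"
  "dual_act (c *\<^sub>C f) x = c *\<^sub>C dual_act f x"
  by (simp_all add: cdual_apply_inject[symmetric] fun_eq_iff dual_act.rep_eq plus_cdual.rep_eq
      scaleC_cdual.rep_eq distrib_right cdual_apply_add mult_scaleC_left cdual_apply_scaleC)

lemma bidual_act_bound:
  "cmod (cdual_apply \<Psi> (dual_act f x)) \<le> norm \<Psi> * norm f * norm x"
proof -
  have "cmod (cdual_apply \<Psi> (dual_act f x)) \<le> norm \<Psi> * norm (dual_act f x)"
    by (rule cdual_apply_bound)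
  also have "\<dots> \<le> norm \<Psi> * (norm f * norm x)"
    by (intro mult_left_mono norm_dual_act norm_ge_zero)
  finally show ?thesis by (simp add: mult.assoc)
qed

lift_definition bidual_act :: "'a :: cstar_algebra bidual \<Rightarrow> 'a cdual \<Rightarrow> 'a cdual" is
  "\<lambda>\<Psi> f x. cdual_apply \<Psi> (dual_act f x)"
proof -
  fix \<Psi> :: "'a bidual" and f :: "'a cdual"
  show "bounded_clinear (\<lambda>x. cdual_apply \<Psi> (dual_act f x))"
    by (rule bounded_clinearI[where K = "norm \<Psi> * norm f"])
      (simp_all add: dual_act_linear cdual_apply_add cdual_apply_scaleC bidual_act_bound)
qed

lemma norm_bidual_act: "norm (bidual_act \<Psi> f) \<le> norm \<Psi> * norm f"
  by (rule norm_cdual_le) (simp_all add: bidual_act.rep_eq bidual_act_bound)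

lemma bidual_act_linear:
  "bidual_act \<Psi> (f + g) = bidual_act \<Psi> f + bidual_act \<Psi> g"
  "bidual_act \<Psi> (c *\<^sub>C f) = c *\<^sub>C bidual_act \<Psi> f"
  by (simp_all add: cdual_apply_inject[symmetric] fun_eq_iff bidual_act.rep_eq plus_cdual.rep_eq
      scaleC_cdual.rep_eq dual_act_linear cdual_apply_add cdual_apply_scaleC)

lift_definition arens :: "'a :: cstar_algebra bidual \<Rightarrow> 'a bidual \<Rightarrow> 'a bidual"
    (infixl \<open>\<odot>\<close> 70) is
  "\<lambda>\<Phi> \<Psi> f. cdual_apply \<Phi> (bidual_act \<Psi> f)"
proof -
  fix \<Phi> \<Psi> :: "'a bidual"
  show "bounded_clinear (\<lambda>f. cdual_apply \<Phi> (bidual_act \<Psi> f))"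
  proof (rule bounded_clinearI[where K = "norm \<Phi> * norm \<Psi>"])
    fix f :: "'a cdual"
    have "cmod (cdual_apply \<Phi> (bidual_act \<Psi> f)) \<le> norm \<Phi> * norm (bidual_act \<Psi> f)"
      by (rule cdual_apply_bound)
    also have "\<dots> \<le> norm \<Phi> * (norm \<Psi> * norm f)"
      by (intro mult_left_mono norm_bidual_act norm_ge_zero)
    finally show "cmod (cdual_apply \<Phi> (bidual_act \<Psi> f)) \<le> norm \<Phi> * norm \<Psi> * norm f"
      by (simp add: mult.assoc)
  qed (simp_all add: bidual_act_linear cdual_apply_add cdual_apply_scaleC)
qed

lemma bidual_embed_mult: "bidual_embed (x * y) = bidual_embed x \<odot> bidual_embed y"
  by (simp add: cdual_apply_inject[symmetric] fun_eq_iff arens.rep_eq bidual_embed.rep_eq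
      bidual_act.rep_eq dual_act.rep_eq)

text \<open>The involution of the bidual: \<open>f\<^sup>*(x)\<close> is the conjugate of \<open>f (x\<^sup>*)\<close>, and
  \<open>\<Phi>\<^sup>*(f)\<close> is the conjugate of \<open>\<Phi> (f\<^sup>*)\<close>.\<close>

lift_definition dual_star :: "'a :: cstar_algebra cdual \<Rightarrow> 'a cdual" is
  "\<lambda>f x. cnj (cdual_apply f (star x))"
proof -
  fix f :: "'a cdual"
  show "bounded_clinear (\<lambda>x. cnj (cdual_apply f (star x)))"
  proof (rule bounded_clinearI[where K = "norm f"])
    show "cmod (cnj (cdual_apply f (star x))) \<le> norm f * norm x" for x
      using cdual_apply_bound[of f "star x"] by (simp add: norm_star)
  qed (simp_all add: star_add star_scaleC cdual_apply_add cdual_apply_scaleC)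
qed

lemma norm_dual_star: "norm (dual_star f) \<le> norm f"
proof (rule norm_cdual_le)
  show "cmod (cdual_apply (dual_star f) x) \<le> norm f * norm x" for x
    using cdual_apply_bound[of f "star x"] by (simp add: norm_star dual_star.rep_eq)
qed simp

lemma dual_star_linear:
  "dual_star (f + g) = dual_star f + dual_star g"
  "dual_star (c *\<^sub>C f) = cnj c *\<^sub>C dual_star f"
  by (simp_all add: cdual_apply_inject[symmetric] fun_eq_iff dual_star.rep_eq plus_cdual.rep_eq
      scaleC_cdual.rep_eq)

lift_definition bidual_star :: "'a :: cstar_algebra bidual \<Rightarrow> 'a bidual" is
  "\<lambda>\<Phi> f. cnj (cdual_apply \<Phi> (dual_star f))"
proof -
  fix \<Phi> :: "'a bidual"
  show "bounded_clinear (\<lambda>f. cnj (cdual_apply \<Phi> (dual_star f)))"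
  proof (rule bounded_clinearI[where K = "norm \<Phi>"])
    fix f :: "'a cdual"
    have "cmod (cdual_apply \<Phi> (dual_star f)) \<le> norm \<Phi> * norm (dual_star f)"
      by (rule cdual_apply_bound)
    also have "\<dots> \<le> norm \<Phi> * norm f"
      by (intro mult_left_mono norm_dual_star norm_ge_zero)
    finally show "cmod (cnj (cdual_apply \<Phi> (dual_star f))) \<le> norm \<Phi> * norm f"
      by simp
  qed (simp_all add: dual_star_linear cdual_apply_add cdual_apply_scaleC)
qed

lemma bidual_embed_star: "bidual_embed (star x) = bidual_star (bidual_embed x)"
  by (simp add: cdual_apply_inject[symmetric] fun_eq_iff bidual_star.rep_eq bidual_embed.rep_eq
      dual_star.rep_eq star_star)

definition bidual_positive :: "'a :: cstar_algebra bidual \<Rightarrow> bool" where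
  "bidual_positive \<Phi> \<longleftrightarrow> (\<exists>\<Theta>. \<Phi> = bidual_star \<Theta> \<odot> \<Theta>)"

definition bidual_le :: "'a :: cstar_algebra bidual \<Rightarrow> 'a bidual \<Rightarrow> bool"
    (infix \<open>\<preceq>\<^sub>*\<^sub>*\<close> 50) where
  "\<Phi> \<preceq>\<^sub>*\<^sub>* \<Psi> \<longleftrightarrow> bidual_positive (\<Psi> - \<Phi>)"

definition bidual_projection :: "'a :: cstar_algebra bidual \<Rightarrow> bool" where
  "bidual_projection q \<longleftrightarrow> bidual_star q = q \<and> q \<odot> q = q"

text \<open>For a subspace \<open>S\<close> this is the bipolar \<open>S\<^sup>\<bottom>\<^sup>\<bottom>\<close>, which is
  identified with the bidual of \<open>S\<close>.\<close>

definition bidual_of :: "'a :: cstar_algebra set \<Rightarrow> 'a bidual set" where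
  "bidual_of S = weak_star_topology closure_of (bidual_embed ` S)"

text \<open>\<open>peak_limit a u\<close> says that the weak* limit \<open>u(a)\<close> of \<open>a (a\<^sup>* a)\<^sup>n\<close> is
  \<open>u\<close>. The weak* topology is Hausdorff, so \<open>u\<close> is determined by \<open>a\<close>.\<close>

definition peak_limit :: "'a :: cstar_algebra \<Rightarrow> 'a bidual \<Rightarrow> bool" where
  "peak_limit a u \<longleftrightarrow>
     limitin weak_star_topology (\<lambda>n. bidual_embed (a * (star a * a) ^ n)) u sequentially"

definition peaks_at :: "'a :: cstar_algebra \<Rightarrow> 'a bidual \<Rightarrow> bool" where
  "peaks_at a q \<longleftrightarrow> peak_limit a q \<and> bidual_projection q"

end

theory Submission
  imports Defs
begin

text \<open>
  The interpolating element is sought in the form \<open>x = b g\<close>, with \<open>g\<close> in the norm closed convex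
  semigroup of contractions that fix \<open>q\<close>, multiply \<open>A\<close> into itself and commute with everything that
  commutes with \<open>a\<close>; it contains 1 and \<open>a\<close>. Then \<open>x\<close> lies in \<open>A\<close> and \<open>x q = b g q = b q\<close>. Put
  \<open>s = sqrt d\<close> and \<open>c = s^-1 b* b s^-1\<close>. As \<open>d\<close> and \<open>b* b\<close> commute with \<open>a\<close>, the required
  \<open>x* x \<le> d\<close> becomes \<open>g* c g \<le> 1\<close>, and the hypothesis becomes \<open>c \<le> 1\<close> on the peak \<open>q\<close>. This is the
  noncommutative version of multiplying a function that is at most 1 on a peak set by functions
  that equal 1 there and are small elsewhere.

  Let \<open>z\<close> be the positive part of \<open>c - 1\<close>. It is annihilated by \<open>q\<close>, and \<open>q\<close> is the limit of
  the decreasing sequence \<open>(a* a)^n\<close>, so \<open>z\<^sup>3 (a* a)^n\<close> decreases weakly to 0. As for continuous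
  functions in Dini's theorem, the convergence is in norm (\<open>positive_functional_above\<close>,
  \<open>peak_compressed_to_zero\<close>). The Cesaro means of the powers of \<open>a\<close>, which do lie in the semigroup,
  absorb \<open>(a* a)^n\<close> asymptotically (\<open>cesaro_asymptotically_fixed\<close>); so the semigroup contains
  elements \<open>k\<close> with \<open>z\<^sup>2 k\<close> arbitrarily small. Given \<open>g\<close> with \<open>g* c g \<le> 1 + e\<close>, mixing in a small
  proportion of \<open>g k\<close> reduces \<open>e\<close> by a fixed factor at the cost of moving \<open>g\<close> by \<open>O(e)\<close>
  (\<open>improve\<close>), and the iteration converges to an exact solution (\<open>exact_interpolation\<close>).

  Positivity in a C*-algebra is developed from the norm alone: square roots come from the binomial
  series, and positivity of \<open>c* c\<close> is proved by an elementary form of Kaplansky's argument. The bidual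
  enters only through evaluation at functionals; the one fact about its order that is needed is
  that \<open>\<Theta>* \<Theta>\<close> is nonnegative at positive functionals (\<open>bidual_square_nonneg\<close>).
\<close>

section \<open>The involution\<close>

lemma star_zero [simp]: "star (0 :: 'a :: cstar_algebra) = 0"
  using star_add[of "0 :: 'a" 0] by simp

lemma star_minus [simp]: "star (- x) = - star (x :: 'a :: cstar_algebra)"
  using star_add[of x "- x"] by (simp add: eq_neg_iff_add_eq_0 add.commute)

lemma star_diff: "star (x - y) = star x - star (y :: 'a :: cstar_algebra)"
  using star_add[of x "- y"] by simp

lemma star_scaleR: "star (r *\<^sub>R x) = r *\<^sub>R star (x :: 'a :: cstar_algebra)"
  by (simp add: scaleR_scaleC star_scaleC)

lemma star_one [simp]: "star (1 :: 'a :: cstar_algebra) = 1"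
  by (metis mult_1_left mult_1_right star_mult star_star)

lemmas star_simps = star_add star_diff star_scaleR star_mult star_star norm_star

lemma star_power: "star (x ^ n) = star (x :: 'a :: cstar_algebra) ^ n"
  by (induction n) (simp_all add: star_mult power_commutes)

lemma commute_power: "y * h = h * y \<Longrightarrow> y * h ^ k = h ^ k * (y :: 'a :: monoid_mult)"
  by (metis power_commuting_commutes)

lemma bounded_linear_star: "bounded_linear (star :: 'a :: cstar_algebra \<Rightarrow> 'a)"
  by (rule bounded_linear_intro[where K = 1]) (simp_all add: star_simps)

lemma norm_self_adjoint_square:
  "star x = (x :: 'a :: cstar_algebra) \<Longrightarrow> norm (x * x) = (norm x)\<^sup>2"
  using norm_star_mult_self[of x] by simp

lemma star_mult_self_eq_0: "star x * x = 0 \<Longrightarrow> x = (0 :: 'a :: cstar_algebra)"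
  using norm_star_mult_self[of x] by simp

lemma star_commute:
  "star y = y \<Longrightarrow> y * x = x * y \<Longrightarrow> y * star x = star x * (y :: 'a :: cstar_algebra)"
  by (metis star_mult)

lemma scaleC_diff_right: "c *\<^sub>C (x - y) = c *\<^sub>C x - c *\<^sub>C (y :: 'a :: complex_normed_vector)"
  using scaleC_add_right[of c "x - y" y] by simp

lemma scaleC_minus_left: "(- c) *\<^sub>C x = - (c *\<^sub>C (x :: 'a :: complex_normed_vector))"
  using scaleC_add_left[of "- c" c x] scaleR_scaleC[of 0 x] by (simp add: eq_neg_iff_add_eq_0)

section \<open>Square roots by the binomial series\<close>

text \<open>The Taylor coefficients of \<open>sqrt (1 - z)\<close> at 0. Apart from the first they are all
  \<open>\<le> 0\<close> and their partial sums stay \<open>\<ge> 0\<close>, so the series converges absolutely on the closed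
  unit disc, boundary included. The boundary matters: it is what makes positive elements that are
  not invertible accessible.\<close>

definition sqrt_coeff :: "nat \<Rightarrow> real" where
  "sqrt_coeff n = ((1/2) gchoose n) * (-1) ^ n"

lemma sqrt_coeff_0 [simp]: "sqrt_coeff 0 = 1"
  by (simp add: sqrt_coeff_def)

lemma prod_minus_shift:
  "(-1) ^ n * (\<Prod>i = 0..<n. c - real i) = (\<Prod>i = 0..<n. real i - c)"
proof (induction n)
  case (Suc n)
  then show ?case by (simp add: Suc.IH[symmetric] algebra_simps)
qed simp

lemma sqrt_coeff_neg: "sqrt_coeff (Suc n) \<le> 0"
proof -
  have "(\<Prod>i = 0..<Suc n. real i - 1/2) = - (\<Prod>i = Suc 0..<Suc n. real i - 1/2) / 2"
    by (subst prod.atLeast_Suc_lessThan) simp_all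
  moreover have "(\<Prod>i = Suc 0..<Suc n. real i - 1/2) \<ge> 0"
    by (rule prod_nonneg) auto
  ultimately have "(\<Prod>i = 0..<Suc n. real i - 1/2) / fact (Suc n) \<le> 0"
    by (simp add: divide_nonpos_pos del: prod.op_ivl_Suc)
  then show ?thesis
    unfolding sqrt_coeff_def gbinomial_prod_rev prod_minus_shift[symmetric] by (simp add: mult.commute)
qed

lemma sqrt_coeff_partial_sum: "(\<Sum>k\<le>n. sqrt_coeff k) \<ge> 0"
proof -
  have "(\<Sum>k\<le>n. sqrt_coeff k) = (-1) ^ n * (((1/2 :: real) - 1) gchoose n)"
    unfolding sqrt_coeff_def by (rule gbinomial_sum_lower_neg)
  also have "\<dots> = (\<Prod>i = 0..<n. real i + 1/2) / fact n"
    using prod_minus_shift[of n "-1/2"] unfolding gbinomial_prod_rev by simp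
  also have "\<dots> \<ge> 0" by (intro divide_nonneg_nonneg prod_nonneg) auto
  finally show ?thesis .
qed

lemma sqrt_coeff_abs_sum: "(\<Sum>k<n. \<bar>sqrt_coeff (Suc k)\<bar>) \<le> 1"
proof -
  have "(\<Sum>k<n. \<bar>sqrt_coeff (Suc k)\<bar>) = - (\<Sum>k<n. sqrt_coeff (Suc k))"
    by (simp add: sum_negf[symmetric] sqrt_coeff_neg abs_of_nonpos)
  also have "\<dots> = 1 - (\<Sum>k\<le>n. sqrt_coeff k)"
    by (simp add: lessThan_Suc_atMost[symmetric] sum.lessThan_Suc_shift del: sum.lessThan_Suc)
  finally show ?thesis using sqrt_coeff_partial_sum[of n] by linarith
qed

lemma sqrt_coeff_convolution:
  "(\<Sum>k\<le>n. sqrt_coeff k * sqrt_coeff (n - k)) = (if n = 0 then 1 else if n = 1 then -1 else 0)"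
proof -
  have "(\<Sum>k\<le>n. sqrt_coeff k * sqrt_coeff (n - k)) =
      (-1) ^ n * (\<Sum>k\<le>n. ((1/2 :: real) gchoose k) * ((1/2) gchoose (n - k)))"
    unfolding sum_distrib_left sqrt_coeff_def
    by (rule sum.cong) (auto simp: power_add[symmetric] algebra_simps)
  also have "\<dots> = (-1) ^ n * (1 gchoose n)"
    using gbinomial_Vandermonde[of "1/2 :: real" "1/2" n] by (simp add: atMost_atLeast0)
  also have "\<dots> = (if n = 0 then 1 else if n = 1 then -1 else 0)"
    using binomial_gbinomial[of 1 n, where 'a = real] by (auto simp: binomial_eq_0)
  finally show ?thesis .
qed

text \<open>The root of \<open>1 - h\<close> is a limit of polynomials in \<open>h\<close>, hence commutes with everything
  that commutes with \<open>h\<close>. The bound on \<open>1 - r\<close> comes from the coefficients after the first having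
  absolute sum at most 1, and it makes \<open>r\<close> positive in the norm sense of \<open>nonneg_elt\<close> below.\<close>

lemma sqrt_one_minus:
  fixes h :: "'a :: cstar_algebra"
  assumes h: "star h = h" and n: "norm h \<le> 1"
  obtains r where "star r = r" "r * r = 1 - h" "norm (1 - r) \<le> 1"
    "\<And>y. y * h = h * y \<Longrightarrow> y * r = r * y"
proof -
  define f where "f k = sqrt_coeff k *\<^sub>R h ^ k" for k
  define r where "r = suminf f"
  have bd: "norm (f k) \<le> \<bar>sqrt_coeff k\<bar>" for k
  proof -
    have "norm (h ^ k) \<le> norm h ^ k" by (rule norm_power_ineq)
    also have "\<dots> \<le> 1" using n by (simp add: power_le_one)
    finally have "\<bar>sqrt_coeff k\<bar> * norm (h ^ k) \<le> \<bar>sqrt_coeff k\<bar>" by (simp add: mult_left_le)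
    then show ?thesis by (simp add: f_def)
  qed
  have sc: "summable (\<lambda>k. \<bar>sqrt_coeff (Suc k)\<bar>)"
    by (rule bounded_imp_summable[where B = 1])
      (use sqrt_coeff_abs_sum[of "Suc _"] in \<open>simp_all add: lessThan_Suc_atMost\<close>)
  then have sc': "summable (\<lambda>k. \<bar>sqrt_coeff k\<bar>)"
    by (subst (asm) summable_Suc_iff)
  have sn: "summable (\<lambda>k. norm (f k))"
    by (rule summable_comparison_test'[OF sc', where N = 0]) (use bd in simp)
  then have sf: "summable f" by (rule summable_norm_cancel)
  have comm: "y * r = r * y" if "y * h = h * y" for y
  proof -
    have "y * h ^ k = h ^ k * y" for k using that by (rule commute_power)
    then have "y * f k = f k * y" for k by (simp add: f_def)
    then show ?thesis unfolding r_def by (simp add: suminf_mult[OF sf, symmetric] suminf_mult2[OF sf])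
  qed
  have "star r = (\<Sum>k. star (f k))"
    unfolding r_def by (rule bounded_linear.suminf[OF bounded_linear_star sf])
  also have "\<dots> = r" by (simp add: r_def f_def[abs_def] star_scaleR star_power h)
  finally have s: "star r = r" .
  have "(\<lambda>k. \<Sum>i\<le>k. f i * f (k - i)) sums (r * r)"
    unfolding r_def by (rule Cauchy_product_sums[OF sn sn])
  moreover have "(\<Sum>i\<le>k. f i * f (k - i)) = (if k = 0 then 1 else if k = 1 then - h else 0)" for k
  proof -
    have "(\<Sum>i\<le>k. f i * f (k - i)) = (\<Sum>i\<le>k. sqrt_coeff i * sqrt_coeff (k - i)) *\<^sub>R h ^ k"
      unfolding scaleR_sum_left
      by (rule sum.cong) (auto simp: f_def power_add[symmetric])
    then show ?thesis by (simp add: sqrt_coeff_convolution)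
  qed
  ultimately have "(\<lambda>k. if k = 0 then 1 else if k = 1 then - h else 0) sums (r * r)" by simp
  moreover have "(\<lambda>k. if k = 0 then 1 else if k = 1 then - h else 0) sums
      (\<Sum>k\<in>{0, 1::nat}. if k = 0 then 1 else if k = 1 then - h else 0)"
    by (rule sums_finite) auto
  ultimately have rr: "r * r = 1 - h" by (simp add: sums_iff)
  have "1 - r = - (\<Sum>k. f (Suc k))"
    using suminf_split_head[OF sf] by (simp add: r_def f_def)
  then have "norm (1 - r) = norm (\<Sum>k. f (Suc k))" by simp
  also have "\<dots> \<le> (\<Sum>k. \<bar>sqrt_coeff (Suc k)\<bar>)"
    by (rule norm_suminf_le[OF bd sc])
  also have "\<dots> \<le> 1"
    by (rule suminf_le_const[OF sc]) (rule sqrt_coeff_abs_sum)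
  finally show ?thesis using that s rr comm by blast
qed

section \<open>The positive cone\<close>

text \<open>For self-adjoint \<open>x\<close> the inequality \<open>\<parallel>t - x\<parallel> \<le> t\<close> says that the spectrum lies in
  \<open>[0, 2t]\<close>. This norm form of positivity makes sums, scalings and square roots immediate without
  spectral theory; that it agrees with being of the form \<open>c* c\<close> is the content of
  \<open>cstar_positive_iff_nonneg_elt\<close>.\<close>

definition nonneg_elt :: "'a :: cstar_algebra \<Rightarrow> bool" where
  "nonneg_elt x \<longleftrightarrow> star x = x \<and> (\<exists>t. norm (t *\<^sub>R 1 - x) \<le> t)"

lemma nonneg_elt_star: "nonneg_elt x \<Longrightarrow> star x = x"
  by (simp add: nonneg_elt_def)

lemma nonneg_elt_add:
  assumes "nonneg_elt x" "nonneg_elt y" shows "nonneg_elt (x + y)"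
proof -
  obtain s t where "norm (s *\<^sub>R 1 - x) \<le> s" "norm (t *\<^sub>R 1 - y) \<le> t"
    using assms by (auto simp: nonneg_elt_def)
  then have "norm ((s + t) *\<^sub>R 1 - (x + y)) \<le> s + t"
    using norm_triangle_ineq[of "s *\<^sub>R 1 - x" "t *\<^sub>R 1 - y"] by (simp add: algebra_simps)
  then show ?thesis using assms unfolding nonneg_elt_def by (auto simp: star_add)
qed

lemma nonneg_elt_scaleR:
  assumes "nonneg_elt x" "r \<ge> 0" shows "nonneg_elt (r *\<^sub>R x)"
proof -
  obtain t where t: "norm (t *\<^sub>R 1 - x) \<le> t" using assms by (auto simp: nonneg_elt_def)
  have "norm ((r * t) *\<^sub>R 1 - r *\<^sub>R x) = r * norm (t *\<^sub>R 1 - x)"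
    using assms(2) by (simp add: scaleR_scaleR[symmetric] scaleR_diff_right[symmetric] del: scaleR_scaleR)
  also have "\<dots> \<le> r * t" using t assms(2) by (rule mult_left_mono)
  finally show ?thesis using assms unfolding nonneg_elt_def by (auto simp: star_scaleR)
qed

lemma nonneg_elt_sub_norm:
  "star x = x \<Longrightarrow> norm x \<le> t \<Longrightarrow> nonneg_elt (t *\<^sub>R 1 - x)"
  unfolding nonneg_elt_def by (auto simp: star_simps intro!: exI[of _ t])

lemma nonneg_elt_0 [simp]: "nonneg_elt 0"
  unfolding nonneg_elt_def by (auto intro!: exI[of _ 0])

lemma nonneg_elt_1 [simp]: "nonneg_elt 1"
  unfolding nonneg_elt_def by (auto intro!: exI[of _ 1])

lemma nonneg_elt_sqrt:
  fixes x :: "'a :: cstar_algebra"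
  assumes "nonneg_elt x"
  obtains r where "nonneg_elt r" "r * r = x" "\<And>y. y * x = x * y \<Longrightarrow> y * r = r * y"
proof -
  obtain t where t: "norm (t *\<^sub>R 1 - x) \<le> t" and sx: "star x = x"
    using assms by (auto simp: nonneg_elt_def)
  have t0: "t \<ge> 0" using t norm_ge_zero order_trans by blast
  show ?thesis
  proof (cases "t = 0")
    case True
    with t have "x = 0" by simp
    then show ?thesis by (intro that[of 0]) auto
  next
    case False
    with t0 have tp: "t > 0" by simp
    define h where "h = 1 - inverse t *\<^sub>R x"
    have "t *\<^sub>R h = t *\<^sub>R 1 - x" using tp by (simp add: h_def scaleR_diff_right)
    then have "t * norm h \<le> t" using t tp by (metis abs_of_pos norm_scaleR)
    then have nh: "norm h \<le> 1" using tp by simp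
    have "star h = h" by (simp add: h_def star_simps sx)
    from sqrt_one_minus[OF this nh] obtain r where r: "star r = r" "r * r = 1 - h"
      "norm (1 - r) \<le> 1" "\<And>y. y * h = h * y \<Longrightarrow> y * r = r * y" by blast
    have "nonneg_elt r" unfolding nonneg_elt_def using r(1,3) by (intro conjI exI[of _ 1]) simp_all
    then have "nonneg_elt (sqrt t *\<^sub>R r)" by (rule nonneg_elt_scaleR) (use tp in simp)
    moreover have "(sqrt t *\<^sub>R r) * (sqrt t *\<^sub>R r) = x"
      using r(2) tp by (simp add: h_def mult.assoc[symmetric])
    moreover have "y * (sqrt t *\<^sub>R r) = (sqrt t *\<^sub>R r) * y" if "y * x = x * y" for y
    proof -
      have "y * h = h * y" using that by (simp add: h_def algebra_simps)
      then show ?thesis using r(4)[of y] by simp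
    qed
    ultimately show ?thesis by (rule that)
  qed
qed

text \<open>The element \<open>r + i w\<close> is the square root of \<open>t\<close> times a unitary, so it has norm \<open>sqrt t\<close>,
  and \<open>r\<close> is its real part. This replaces the spectral radius formula: it turns an algebraic
  identity into a norm bound.\<close>

lemma unitary_parts:
  fixes r w :: "'a :: cstar_algebra"
  assumes "star r = r" "star w = w" "r * w = w * r" "r * r + w * w = t *\<^sub>R 1" 
  shows "norm r \<le> sqrt \<bar>t\<bar>"
proof -
  define u where "u = r + \<i> *\<^sub>C w"
  have i2: "\<i> *\<^sub>C \<i> *\<^sub>C x = - x" for x :: 'a
    using scaleR_scaleC[of "-1" x] by (simp add: scaleC_scaleC)
  have su: "star u = r - \<i> *\<^sub>C w"
    using assms(1,2) by (simp add: u_def star_add star_scaleC scaleC_minus_left)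
  have "star u * u = r * r + w * w"
    unfolding su unfolding u_def
    by (simp add: algebra_simps mult_scaleC_left mult_scaleC_right scaleC_diff_right i2 assms(3))
  then have "(norm u)\<^sup>2 = \<bar>t\<bar>"
    using norm_star_mult_self[of u] assms(4) by simp
  then have nu: "norm u = sqrt \<bar>t\<bar>" by (metis norm_ge_zero real_sqrt_unique)
  have "2 *\<^sub>R r = u + star u" unfolding su unfolding u_def by (simp add: scaleR_2)
  then have "2 * norm r \<le> norm u + norm (star u)"
    using norm_triangle_ineq[of u "star u"] by (metis abs_numeral norm_scaleR)
  then show ?thesis using nu by (simp add: norm_star)
qed

text \<open>After scaling to norm at most 1, complete \<open>y\<close> to a unitary \<open>r + i y\<close> with
  \<open>r\<^sup>2 = 1 - y\<^sup>2\<close>; then \<open>\<parallel>1 - y\<^sup>2\<parallel> = \<parallel>r\<parallel>\<^sup>2 \<le> 1\<close>.\<close>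

lemma nonneg_elt_square:
  fixes x :: "'a :: cstar_algebra"
  assumes sx: "star x = x"
  shows "nonneg_elt (x * x)"
proof -
  define k where "k = norm x + 1"
  have k: "k > 0" "norm x \<le> k" by (simp_all add: k_def add_nonneg_pos)
  define y where "y = inverse k *\<^sub>R x"
  have sy: "star y = y" by (simp add: y_def star_scaleR sx)
  have "norm y \<le> 1" using k by (simp add: y_def field_simps)
  then have n1: "norm (y * y) \<le> 1" by (simp add: norm_self_adjoint_square sy power_le_one)
  have "star (y * y) = y * y" by (simp add: star_mult sy)
  from sqrt_one_minus[OF this n1] obtain r where r: "star r = r" "r * r = 1 - y * y"
    "\<And>u. u * (y * y) = (y * y) * u \<Longrightarrow> u * r = r * u" by blast
  have "r * y = y * r" using r(3)[of y] by (simp add: mult.assoc)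
  then have "norm r \<le> sqrt \<bar>1\<bar>"
    by (intro unitary_parts[OF r(1) sy]) (simp_all add: r(2))
  then have "norm (r * r) \<le> 1" by (simp add: norm_self_adjoint_square r(1) power_le_one)
  then have "nonneg_elt (y * y)"
    unfolding nonneg_elt_def using r(2) by (auto simp: star_mult sy intro!: exI[of _ 1])
  then have "nonneg_elt ((k * k) *\<^sub>R (y * y))" by (rule nonneg_elt_scaleR) (use k in simp)
  moreover have "k * k * (inverse k * inverse k) = 1" using k(1) by (simp add: field_simps)
  then have "(k * k) *\<^sub>R (y * y) = x * x" by (simp add: y_def)
  ultimately show ?thesis by simp
qed

lemma nonneg_elt_mult:
  fixes x y :: "'a :: cstar_algebra"
  assumes "nonneg_elt x" "nonneg_elt y" "x * y = y * x"
  shows "nonneg_elt (x * y)"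
proof -
  obtain r where r: "nonneg_elt r" "r * r = x" "\<And>u. u * x = x * u \<Longrightarrow> u * r = r * u"
    using nonneg_elt_sqrt[OF assms(1)] by blast
  obtain w where w: "nonneg_elt w" "w * w = y" "\<And>u. u * y = y * u \<Longrightarrow> u * w = w * u"
    using nonneg_elt_sqrt[OF assms(2)] by blast
  have "y * r = r * y" using r(3)[of y] assms(3) by simp
  then have rw: "r * w = w * r" using w(3)[of r] by simp
  have "star (r * w) = r * w" by (simp add: star_mult nonneg_elt_star r(1) w(1) rw)
  then have "nonneg_elt ((r * w) * (r * w))" by (rule nonneg_elt_square)
  moreover have "(r * w) * (r * w) = x * y"
    by (metis mult.assoc r(2) rw w(2))
  ultimately show ?thesis by simp
qed

lemma norm_le_of_nonneg_elt:
  fixes x :: "'a :: cstar_algebra"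
  assumes "nonneg_elt x" "nonneg_elt (t *\<^sub>R 1 - x)"
  shows "norm x \<le> \<bar>t\<bar>"
proof -
  obtain r where r: "nonneg_elt r" "r * r = x" "\<And>u. u * x = x * u \<Longrightarrow> u * r = r * u"
    using nonneg_elt_sqrt[OF assms(1)] by blast
  obtain w where w: "nonneg_elt w" "w * w = t *\<^sub>R 1 - x"
    "\<And>u. u * (t *\<^sub>R 1 - x) = (t *\<^sub>R 1 - x) * u \<Longrightarrow> u * w = w * u"
    using nonneg_elt_sqrt[OF assms(2)] by blast
  have "x * r = r * x" using r(3)[of x] by simp
  then have "r * w = w * r" using w(3)[of r] by (simp add: algebra_simps)
  then have "norm r \<le> sqrt \<bar>t\<bar>"
    by (intro unitary_parts[OF nonneg_elt_star[OF r(1)] nonneg_elt_star[OF w(1)]])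
      (simp_all add: r(2) w(2))
  then have "(norm r)\<^sup>2 \<le> (sqrt \<bar>t\<bar>)\<^sup>2" by (intro power_mono) auto
  then show ?thesis
    using norm_self_adjoint_square[of r] r(1,2) by (simp add: nonneg_elt_star)
qed

text \<open>In the definition of positivity any \<open>t \<ge> \<parallel>x\<parallel>\<close> will do. This uniformity is what
  makes the cone closed.\<close>

lemma nonneg_elt_imp_norm_le:
  fixes x :: "'a :: cstar_algebra"
  assumes "nonneg_elt x" "norm x \<le> t"
  shows "norm (t *\<^sub>R 1 - x) \<le> t"
proof -
  have "nonneg_elt (t *\<^sub>R 1 - x)"
    by (rule nonneg_elt_sub_norm) (use assms in \<open>auto simp: nonneg_elt_star\<close>)
  moreover have "t \<ge> 0" using assms(2) norm_ge_zero order_trans by blast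
  ultimately show ?thesis
    using norm_le_of_nonneg_elt[of "t *\<^sub>R 1 - x" t] assms(1) by simp
qed

lemma norm_mono_nonneg_elt:
  fixes x y :: "'a :: cstar_algebra"
  assumes "nonneg_elt x" "nonneg_elt (y - x)"
  shows "norm x \<le> norm y"
proof -
  have y: "nonneg_elt y" using nonneg_elt_add[OF assms] by simp
  have "nonneg_elt (norm y *\<^sub>R 1 - y)"
    by (rule nonneg_elt_sub_norm) (use y in \<open>auto simp: nonneg_elt_star\<close>)
  from nonneg_elt_add[OF this assms(2)] have "nonneg_elt (norm y *\<^sub>R 1 - x)" by simp
  from norm_le_of_nonneg_elt[OF assms(1) this] show ?thesis by simp
qed

lemma nonneg_elt_antisym:
  fixes x :: "'a :: cstar_algebra"
  assumes "nonneg_elt x" "nonneg_elt (- x)" shows "x = 0"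
  using norm_le_of_nonneg_elt[of x 0] assms by simp

lemma nonneg_elt_sum_zero:
  fixes x y :: "'a :: cstar_algebra"
  assumes "nonneg_elt x" "nonneg_elt y" "x + y = 0" shows "x = 0"
  using nonneg_elt_antisym[of x] assms by (simp add: add_eq_0_iff)

lemma nonneg_elt_limit:
  fixes x :: "nat \<Rightarrow> 'a :: cstar_algebra"
  assumes "\<And>n. nonneg_elt (x n)" "x \<longlonglongrightarrow> l"
  shows "nonneg_elt l"
proof -
  have "(\<lambda>n. star (x n)) \<longlonglongrightarrow> star l"
    using assms(2) by (rule bounded_linear.tendsto[OF bounded_linear_star])
  then have "x \<longlonglongrightarrow> star l" using assms(1) by (simp add: nonneg_elt_star)
  then have "star l = l" using assms(2) LIMSEQ_unique by blast
  moreover obtain K where K: "\<And>n. norm (x n) \<le> K"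
    using convergent_imp_Bseq[OF convergentI[OF assms(2)]] unfolding Bseq_def by auto
  have "norm (K *\<^sub>R 1 - x n) \<le> K" for n
    using nonneg_elt_imp_norm_le[OF assms(1) K] .
  moreover have "(\<lambda>n. norm (K *\<^sub>R 1 - x n)) \<longlonglongrightarrow> norm (K *\<^sub>R 1 - l)"
    by (intro tendsto_intros assms(2))
  ultimately show ?thesis
    unfolding nonneg_elt_def using LIMSEQ_le_const2 by blast
qed

text \<open>The Neumann series for \<open>x + e = (t + e) (1 - h)\<close>, where \<open>\<parallel>h\<parallel> < 1\<close> because
  \<open>\<parallel>t - x\<parallel> \<le> t\<close>.\<close>

lemma nonneg_elt_inverse_shift:
  fixes x :: "'a :: cstar_algebra"
  assumes x: "nonneg_elt x" and e: "e > 0"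
  obtains j where "nonneg_elt j" "j * (x + e *\<^sub>R 1) = 1" "(x + e *\<^sub>R 1) * j = 1"
    "\<And>y. y * x = x * y \<Longrightarrow> y * j = j * y"
proof -
  define t where "t = norm x"
  have t: "t \<ge> 0" "norm (t *\<^sub>R 1 - x) \<le> t"
    using nonneg_elt_imp_norm_le[OF x, of t] by (auto simp: t_def)
  define h where "h = inverse (t + e) *\<^sub>R (t *\<^sub>R 1 - x)"
  have sh: "star h = h" using x by (simp add: h_def star_simps nonneg_elt_star)
  have nh: "norm h < 1" 
  proof -
    have "norm h = inverse (t + e) * norm (t *\<^sub>R 1 - x)"
      using t e by (simp add: h_def)
    also have "\<dots> \<le> inverse (t + e) * t" using t e by (intro mult_left_mono) auto
    also have "\<dots> < 1" using t e by (simp add: field_simps)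
    finally show ?thesis .
  qed
  have eq: "x + e *\<^sub>R 1 = (t + e) *\<^sub>R (1 - h)"
    using t e by (simp add: h_def scaleR_diff_right scaleR_add_left)
  have sn: "summable (\<lambda>n. norm (h ^ n))"
    by (rule summable_comparison_test'[OF summable_geometric[of "norm h"], where N = 0])
      (use nh norm_power_ineq[of h] in auto)
  then have sf: "summable (\<lambda>n. h ^ n)" by (rule summable_norm_cancel)
  define g where "g = (\<Sum>n. h ^ n)"
  have tl: "(\<Sum>n. h ^ Suc n) = g - 1"
    using suminf_split_head[OF sf] by (simp add: g_def)
  have hg: "h * g = g - 1" and gh: "g * h = g - 1"
    using suminf_mult[OF sf, of h] suminf_mult2[OF sf, of h] tl
    by (simp_all add: g_def power_commutes)
  have comm: "y * g = g * y" if "y * h = h * y" for y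
  proof -
    have "y * h ^ k = h ^ k * y" for k using that by (rule commute_power)
    then show ?thesis
      unfolding g_def by (simp add: suminf_mult[OF sf, symmetric] suminf_mult2[OF sf])
  qed
  have "star g = (\<Sum>k. star (h ^ k))"
    unfolding g_def by (rule bounded_linear.suminf[OF bounded_linear_star sf])
  then have sg: "star g = g" by (simp add: g_def star_power sh)
  \<comment> \<open>Positivity of the inverse: \<open>g = g\<^sup>2 (1 - h)\<close> is a product of commuting positive elements.\<close>
  have "nonneg_elt (x + e *\<^sub>R 1)"
    by (intro nonneg_elt_add x nonneg_elt_scaleR) (use e in auto)
  then have "nonneg_elt ((t + e) *\<^sub>R (1 - h))" by (simp add: eq)
  then have "nonneg_elt (inverse (t + e) *\<^sub>R (t + e) *\<^sub>R (1 - h))"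
    by (rule nonneg_elt_scaleR) (use t e in auto)
  then have p1: "nonneg_elt (1 - h)" using t e by simp
  have "nonneg_elt (g * g)" by (rule nonneg_elt_square[OF sg])
  then have "nonneg_elt ((g * g) * (1 - h))"
    by (rule nonneg_elt_mult[OF _ p1]) (simp add: algebra_simps gh, simp add: algebra_simps hg flip: mult.assoc)
  moreover have "(g * g) * (1 - h) = g" by (simp add: algebra_simps gh)
  ultimately have gp: "nonneg_elt g" by simp
  define j where "j = inverse (t + e) *\<^sub>R g"
  have "nonneg_elt j" unfolding j_def by (rule nonneg_elt_scaleR[OF gp]) (use t e in auto)
  moreover have "j * (x + e *\<^sub>R 1) = 1" "(x + e *\<^sub>R 1) * j = 1"
    unfolding eq j_def using t e by (simp_all add: left_diff_distrib right_diff_distrib hg gh flip: scaleR_diff_right)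
  moreover have "y * j = j * y" if "y * x = x * y" for y
  proof -
    have "y * h = h * y" using that by (simp add: h_def algebra_simps)
    then show ?thesis using comm by (simp add: j_def)
  qed
  ultimately show ?thesis by (rule that)
qed

text \<open>With \<open>m = |x|\<close> the parts are \<open>(m + x) / 2\<close> and \<open>(m - x) / 2\<close>; only their positivity
  needs an argument. If \<open>n\<close> is one of them, then \<open>n m = n\<^sup>2\<close>, hence
  \<open>(n + d) (m + 2 d) = (n + d)\<^sup>2 + d m + d\<^sup>2\<close> is positive for \<open>d > 0\<close>. Dividing by the invertible
  \<open>m + 2 d\<close> shows that \<open>n + d\<close> is positive, and \<open>d\<close> tends to 0.\<close>

lemma jordan_decomposition:
  fixes x :: "'a :: cstar_algebra"
  assumes sx: "star x = x"
  obtains p n where "nonneg_elt p" "nonneg_elt n" "x = p - n" "p * n = 0" "n * p = 0"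
    "\<And>y. y * x = x * y \<Longrightarrow> y * p = p * y"
    "\<And>y. y * x = x * y \<Longrightarrow> y * n = n * y"
proof -
  obtain m where m: "nonneg_elt m" "m * m = x * x" "\<And>y. y * (x * x) = x * x * y \<Longrightarrow> y * m = m * y"
    using nonneg_elt_sqrt[OF nonneg_elt_square[OF sx]] by blast
  have mx: "x * m = m * x" using m(3)[of x] by (simp add: mult.assoc)
  have part: "nonneg_elt ((1/2) *\<^sub>R (m - v))"
    if v: "star v = v" "v * v = x * x" "v * m = m * v" for v
  proof -
    define n where "n = (1/2) *\<^sub>R (m - v)"
    have nm: "n * m = n * n" "m * n = n * n"
      by (simp_all add: n_def algebra_simps m(2) v)
        (simp_all add: scaleR_add_right[symmetric] scaleR_2[symmetric] flip: scaleR_add_left)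
    have sn: "star n = n" using m(1) v by (simp add: n_def star_simps nonneg_elt_star)
    have nd: "nonneg_elt (n + d *\<^sub>R 1)" if d: "d > 0" for d
    proof -
      obtain j where j: "nonneg_elt j" "j * (m + (d + d) *\<^sub>R 1) = 1"
        "(m + (d + d) *\<^sub>R 1) * j = 1" "\<And>y. y * m = m * y \<Longrightarrow> y * j = j * y"
        using nonneg_elt_inverse_shift[OF m(1), of "d + d"] d by auto
      define k where "k = (n + d *\<^sub>R 1) * (n + d *\<^sub>R 1) + d *\<^sub>R m + (d * d) *\<^sub>R 1"
      have two: "(r * 2) *\<^sub>R u = r *\<^sub>R u + r *\<^sub>R u" "(r * (s * 2)) *\<^sub>R u = (r * s) *\<^sub>R u + (r * s) *\<^sub>R u"
        for r s and u :: 'a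
        by (metis mult_2_right scaleR_add_left, metis mult.assoc mult_2_right scaleR_add_left)
      have k: "k = (n + d *\<^sub>R 1) * (m + (d + d) *\<^sub>R 1)"
        by (simp add: k_def algebra_simps nm two)
      have "nonneg_elt k" unfolding k_def
        by (intro nonneg_elt_add nonneg_elt_square nonneg_elt_scaleR m(1))
          (use d in \<open>auto simp: star_simps sn\<close>)
      moreover have "k * m = m * k" unfolding k by (simp add: algebra_simps nm) (simp add: nm flip: mult.assoc)
      then have "k * j = j * k" by (rule j(4))
      ultimately have "nonneg_elt (k * j)" using j(1) by (intro nonneg_elt_mult)
      also have "k * j = n + d *\<^sub>R 1" unfolding k by (simp only: mult.assoc j mult_1_right)
      finally show ?thesis .
    qed
    have "(\<lambda>i. n + inverse (real (Suc i)) *\<^sub>R 1) \<longlonglongrightarrow> n + 0 *\<^sub>R 1"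
      by (intro tendsto_intros LIMSEQ_inverse_real_of_nat)
    then have "(\<lambda>i. n + inverse (real (Suc i)) *\<^sub>R 1) \<longlonglongrightarrow> n" by simp
    then show ?thesis unfolding n_def[symmetric]
      by (rule nonneg_elt_limit[rotated]) (intro nd, simp)
  qed
  show ?thesis
  proof
    show "nonneg_elt ((1/2) *\<^sub>R (m - - x))"
      by (rule part) (simp_all add: sx mx)
    show "nonneg_elt ((1/2) *\<^sub>R (m - x))"
      by (rule part) (simp_all add: sx mx)
    show "x = (1/2) *\<^sub>R (m - - x) - (1/2) *\<^sub>R (m - x)"
      by (simp add: algebra_simps flip: scaleR_2)
    show "(1/2) *\<^sub>R (m - - x) * ((1/2) *\<^sub>R (m - x)) = 0"
      by (simp add: algebra_simps m(2) mx)
    show "(1/2) *\<^sub>R (m - x) * ((1/2) *\<^sub>R (m - - x)) = 0"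
      by (simp add: algebra_simps m(2) mx)
    fix y assume y: "y * x = x * y"
    then have "y * (x * x) = x * x * y" by (metis mult.assoc)
    then have "y * m = m * y" by (rule m(3))
    then show "y * ((1/2) *\<^sub>R (m - - x)) = (1/2) *\<^sub>R (m - - x) * y"
      "y * ((1/2) *\<^sub>R (m - x)) = (1/2) *\<^sub>R (m - x) * y"
      by (simp_all add: algebra_simps y)
  qed
qed

section \<open>Elements of the form c* c\<close>

text \<open>The usual argument is that \<open>y* y\<close> and \<open>y y*\<close> have the same nonzero spectrum, while
  \<open>y* y + y y*\<close> is a sum of squares, so both would be positive. Only one spectral point is needed:
  with \<open>N = \<parallel>w\<parallel>\<close>, invertibility of \<open>N + y y*\<close> passes to \<open>N + y* y = N - w\<close>, and the
  bounded inverse keeps \<open>w\<close> strictly below its own norm \<open>N\<close>.\<close>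

lemma star_mult_self_nonpos:
  fixes y w :: "'a :: cstar_algebra"
  assumes w: "nonneg_elt w" and yw: "star y * y = - w"
  shows "w = 0"
proof (rule ccontr)
  assume "w \<noteq> 0"
  define N where "N = norm w"
  have N: "N > 0" using \<open>w \<noteq> 0\<close> by (simp add: N_def)
  define H where "H = y + star y"
  define K where "K = \<i> *\<^sub>C (y - star y)"
  have m1: "(-1) *\<^sub>C u = - u" for u :: 'a
    using scaleR_scaleC[of "-1" u] by simp
  have KK: "K * K = - ((y - star y) * (y - star y))"
    by (simp add: K_def mult_scaleC_left mult_scaleC_right scaleC_scaleC m1)
  have "(-\<i>) *\<^sub>C u = \<i> *\<^sub>C (- u)" for u :: 'a
    by (metis m1 mult_minus1_right scaleC_scaleC)
  then have "star K = K" by (simp add: K_def star_scaleC star_simps)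
  moreover have "star H = H" by (simp add: H_def star_simps add.commute)
  ultimately have "nonneg_elt ((1/2) *\<^sub>R (H * H + K * K) + w)"
    by (intro nonneg_elt_add nonneg_elt_scaleR nonneg_elt_square w) auto
  moreover have "(1/2) *\<^sub>R (H * H + K * K) + w = y * star y"
  proof -
    have "H * H + K * K = 2 *\<^sub>R (y * star y) + 2 *\<^sub>R (star y * y)"
      by (simp add: KK H_def algebra_simps scaleR_2)
    then show ?thesis by (simp add: yw scaleR_diff_right)
  qed
  ultimately have "nonneg_elt (y * star y)" by simp
  then obtain j where j: "nonneg_elt j" "(y * star y + N *\<^sub>R 1) * j = 1"
    using nonneg_elt_inverse_shift N by metis
  define f where "f = N *\<^sub>R 1 - w"
  define g where "g = (1/N) *\<^sub>R (1 - star y * j * y)"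
  have sg: "star g = g" using j(1) by (simp add: g_def star_simps nonneg_elt_star mult.assoc)
  have fg: "f * g = 1"
  proof -
    have "f * (1 - star y * j * y) = N *\<^sub>R 1 + star y * y - star y * ((y * star y + N *\<^sub>R 1) * j) * y"
    proof -
      have "f = N *\<^sub>R 1 + star y * y" by (simp add: f_def yw)
      then show ?thesis by (simp add: algebra_simps)
    qed
    also have "\<dots> = N *\<^sub>R 1" by (simp add: j(2))
    finally show ?thesis using N by (simp add: g_def)
  qed
  have sf: "star f = f" using w by (simp add: f_def star_simps nonneg_elt_star)
  have gf: "g * f = 1" using fg sf sg by (metis star_mult star_one)
  have f: "nonneg_elt f" unfolding f_def
    by (rule nonneg_elt_sub_norm) (use w in \<open>auto simp: nonneg_elt_star N_def\<close>)
  have "nonneg_elt (g * g * f)"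
    by (rule nonneg_elt_mult[OF nonneg_elt_square[OF sg] f]) (simp add: mult.assoc gf, simp add: fg flip: mult.assoc)
  then have g: "nonneg_elt g" by (simp add: mult.assoc gf)
  define k where "k = norm g"
  have "nonneg_elt (f * (k *\<^sub>R 1 - g))"
    by (rule nonneg_elt_mult[OF f nonneg_elt_sub_norm[OF sg]]) (simp_all add: k_def algebra_simps fg gf)
  moreover have "f * (k *\<^sub>R 1 - g) = (k * N - 1) *\<^sub>R 1 - k *\<^sub>R w"
    using fg by (simp add: algebra_simps) (simp add: f_def algebra_simps)
  ultimately have "nonneg_elt ((k * N - 1) *\<^sub>R 1 - k *\<^sub>R w)" by simp
  then have "norm (k *\<^sub>R w) \<le> \<bar>k * N - 1\<bar>"
    by (intro norm_le_of_nonneg_elt nonneg_elt_scaleR w) (simp_all add: k_def)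
  then have "k * N \<le> \<bar>k * N - 1\<bar>" by (simp add: k_def N_def)
  moreover have "norm f \<le> N" unfolding f_def by (rule nonneg_elt_imp_norm_le) (simp_all add: w N_def)
  then have "norm (g * f) \<le> k * N" unfolding k_def
    by (meson mult_left_mono norm_ge_zero norm_mult_ineq order_trans)
  then have "1 \<le> k * N" by (simp add: gf)
  ultimately show False by simp
qed

text \<open>If \<open>n\<close> is the negative part of \<open>c* c\<close>, then \<open>(c n)* (c n) = - n\<^sup>3\<close>, and the previous
  lemma forces \<open>n = 0\<close>.\<close>

lemma nonneg_elt_star_mult_self: "nonneg_elt (star c * (c :: 'a :: cstar_algebra))"
proof -
  have "star (star c * c) = star c * c" by (simp add: star_simps)
  then obtain p n where pn: "nonneg_elt p" "nonneg_elt n" "star c * c = p - n" "p * n = 0" "n * p = 0"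
    by (rule jordan_decomposition)
  have sn: "star n = n" using pn(2) by (rule nonneg_elt_star)
  have "nonneg_elt (n * (n * n))"
    by (rule nonneg_elt_mult[OF pn(2) nonneg_elt_square[OF sn]]) (simp add: mult.assoc)
  moreover have "star (c * n) * (c * n) = n * (star c * c) * n"
    by (simp add: star_mult sn mult.assoc)
  then have "star (c * n) * (c * n) = - (n * (n * n))"
    by (simp add: pn algebra_simps)
  ultimately have "n * (n * n) = 0" by (rule star_mult_self_nonpos)
  then have "star (n * n) * (n * n) = 0" by (simp add: star_mult sn mult.assoc)
  then have "star n * n = 0" using star_mult_self_eq_0 sn by metis
  then have "n = 0" by (rule star_mult_self_eq_0)
  then show ?thesis using pn by simp
qed

lemma cstar_positive_iff_nonneg_elt: "cstar_positive x \<longleftrightarrow> nonneg_elt x"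
proof
  assume "nonneg_elt x"
  then obtain r where "nonneg_elt r" "r * r = x" by (rule nonneg_elt_sqrt)
  then show "cstar_positive x" unfolding cstar_positive_def by (metis nonneg_elt_star)
qed (auto simp: cstar_positive_def nonneg_elt_star_mult_self)

lemma nonneg_elt_conj:
  assumes "nonneg_elt x" shows "nonneg_elt (star y * x * (y :: 'a :: cstar_algebra))"
proof -
  obtain r where r: "nonneg_elt r" "r * r = x" using assms by (rule nonneg_elt_sqrt)
  then have "star y * x * y = star (r * y) * (r * y)"
    by (simp add: star_mult nonneg_elt_star mult.assoc flip: r(2))
  then show ?thesis using nonneg_elt_star_mult_self by metis
qed

lemma nonneg_elt_sqrt_unique_commuting:
  fixes p r :: "'a :: cstar_algebra"
  assumes p: "nonneg_elt p" and r: "nonneg_elt r" and eq: "p * p = r * r" and c: "p * r = r * p"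
  shows "p = r"
proof -
  define D where "D = p - r"
  have sD: "star D = D" using p r by (simp add: D_def star_simps nonneg_elt_star)
  have pr: "p * (r * y) = r * (p * y)" "p * (p * y) = r * (r * y)" for y
    by (simp_all add: c eq flip: mult.assoc)
  note DD = nonneg_elt_square[OF sD]
  have "nonneg_elt (D * D * p)" by (rule nonneg_elt_mult[OF DD p]) (simp add: D_def algebra_simps c eq pr)
  moreover have "nonneg_elt (D * D * r)" by (rule nonneg_elt_mult[OF DD r]) (simp add: D_def algebra_simps c eq pr)
  moreover have z: "D * D * p + D * D * r = 0"
    by (simp add: D_def algebra_simps c eq pr)
  ultimately have "D * D * p = 0" by (rule nonneg_elt_sum_zero)
  moreover from this z have "D * D * r = 0" by simp
  ultimately have "D * D * D = 0" by (simp add: D_def right_diff_distrib)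
  then have "star (D * D) * (D * D) = 0" by (simp add: star_mult sD flip: mult.assoc)
  then have "star D * D = 0" using star_mult_self_eq_0 sD by metis
  then show ?thesis using star_mult_self_eq_0[of D] by (simp add: D_def)
qed

text \<open>The definite description in the definition of the absolute value denotes something: any
  positive root commutes with its square, hence with the root produced by the binomial series,
  and commuting positive roots agree.\<close>

lemma cstar_abs_properties:
  fixes b :: "'a :: cstar_algebra"
  shows "nonneg_elt (cstar_abs b)" "cstar_abs b * cstar_abs b = star b * b"
proof -
  obtain r where r: "nonneg_elt r" "r * r = star b * b"
    "\<And>y. y * (star b * b) = star b * b * y \<Longrightarrow> y * r = r * y"
    using nonneg_elt_sqrt[OF nonneg_elt_star_mult_self] by blast
  have "p = r" if "cstar_positive p \<and> p * p = star b * b" for p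
  proof (rule nonneg_elt_sqrt_unique_commuting)
    show "p * r = r * p" using that by (intro r(3)) (metis mult.assoc)
  qed (use that r(1,2) in \<open>auto simp: cstar_positive_iff_nonneg_elt\<close>)
  then have "\<exists>!p. cstar_positive p \<and> p * p = star b * b"
    using r(1,2) by (auto simp: cstar_positive_iff_nonneg_elt)
  then have "cstar_positive (cstar_abs b) \<and> cstar_abs b * cstar_abs b = star b * b"
    unfolding cstar_abs_def cstar_sqrt_def by (rule theI')
  then show "nonneg_elt (cstar_abs b)" "cstar_abs b * cstar_abs b = star b * b"
    by (auto simp: cstar_positive_iff_nonneg_elt)
qed

section \<open>Sublinear functionals and the Hahn-Banach theorem\<close>

definition sublinear :: "('a :: real_vector \<Rightarrow> real) \<Rightarrow> bool" where
  "sublinear p \<longleftrightarrow> (\<forall>x y. p (x + y) \<le> p x + p y) \<and> (\<forall>t x. t > 0 \<longrightarrow> p (t *\<^sub>R x) = t * p x)"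

lemma sublinear_add: "sublinear p \<Longrightarrow> p (x + y) \<le> p x + p y"
  and sublinear_scaleR: "sublinear p \<Longrightarrow> t > 0 \<Longrightarrow> p (t *\<^sub>R x) = t * p x"
  by (auto simp: sublinear_def)

lemma sublinear_0: "sublinear p \<Longrightarrow> p 0 = 0"
  using sublinear_scaleR[of p 2 0] by simp

lemma sublinear_lower: "sublinear p \<Longrightarrow> - p (- x) \<le> p x"
  using sublinear_add[of p x "- x"] sublinear_0[of p] by simp

lemma Inf_mult_left:
  fixes X :: "real set"
  assumes "X \<noteq> {}" "bdd_below X" "t > 0"
  shows "Inf ((*) t ` X) = t * Inf X"
proof (rule cInf_eq_non_empty)
  show "(*) t ` X \<noteq> {}" using assms by simp
  show "t * Inf X \<le> y" if "y \<in> (*) t ` X" for y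
    using that assms cInf_lower by (auto intro!: mult_left_mono)
  show "y \<le> t * Inf X" if "\<And>x. x \<in> (*) t ` X \<Longrightarrow> y \<le> x" for y
  proof -
    have "y / t \<le> Inf X"
      by (rule cInf_greatest[OF assms(1)]) (use that assms(3) in \<open>auto simp: field_simps\<close>)
    then show ?thesis using assms(3) by (simp add: field_simps)
  qed
qed

lemma sublinear_Inf:
  fixes X :: "'a :: real_vector \<Rightarrow> real set"
  assumes ne: "\<And>x. X x \<noteq> {}" and bd: "\<And>x. bdd_below (X x)"
    and add: "\<And>x y s t. s \<in> X x \<Longrightarrow> t \<in> X y \<Longrightarrow> \<exists>u\<in>X (x + y). u \<le> s + t"
    and scale: "\<And>x s t. s \<in> X x \<Longrightarrow> t > 0 \<Longrightarrow> t * s \<in> X (t *\<^sub>R x)"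
  shows "sublinear (\<lambda>x. Inf (X x))"
  unfolding sublinear_def
proof (intro conjI allI impI)
  fix x y
  have "Inf (X (x + y)) - s \<le> Inf (X y)" if "s \<in> X x" for s
  proof (rule cInf_greatest[OF ne])
    fix t assume "t \<in> X y"
    with add[OF that] obtain u where "u \<in> X (x + y)" "u \<le> s + t" by blast
    then show "Inf (X (x + y)) - s \<le> t" using cInf_lower[OF _ bd] by fastforce
  qed
  then have "Inf (X (x + y)) - Inf (X y) \<le> s" if "s \<in> X x" for s using that by fastforce
  then have "Inf (X (x + y)) - Inf (X y) \<le> Inf (X x)" by (intro cInf_greatest[OF ne])
  then show "Inf (X (x + y)) \<le> Inf (X x) + Inf (X y)" by simp
next
  fix t :: real and x assume t: "t > 0"
  have "X (t *\<^sub>R x) = (*) t ` X x"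
  proof
    show "(*) t ` X x \<subseteq> X (t *\<^sub>R x)" using scale t by blast
    show "X (t *\<^sub>R x) \<subseteq> (*) t ` X x"
    proof
      fix s assume "s \<in> X (t *\<^sub>R x)"
      from scale[OF this, of "inverse t"] t have "inverse t * s \<in> X x" by simp
      then show "s \<in> (*) t ` X x" using t by (intro image_eqI[of _ _ "inverse t * s"]) auto
    qed
  qed
  then show "Inf (X (t *\<^sub>R x)) = t * Inf (X x)" using Inf_mult_left[OF ne bd t] by simp
qed

text \<open>A minimal sublinear functional below \<open>p\<close>, found by Zorn's lemma, is linear.\<close>

lemma hahn_banach_sublinear:
  fixes p :: "'a :: real_vector \<Rightarrow> real"
  assumes p: "sublinear p"
  obtains f where "linear f" "\<And>x. f x \<le> p x"
proof -
  define A where "A = {q. sublinear q \<and> (\<forall>x. q x \<le> p x)}"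
  define P where "P q r \<longleftrightarrow> (\<forall>x. r x \<le> q x)" for q r :: "'a \<Rightarrow> real"
  have "\<exists>m\<in>A. \<forall>q\<in>A. P m q \<longrightarrow> q = m"
  proof (rule predicate_Zorn)
    show "partial_order_on A (relation_of P A)"
      by (rule partial_order_on_relation_ofI) (auto simp: P_def fun_eq_iff intro: order_trans antisym)
    fix C assume "C \<in> Chains (relation_of P A)"
    then have CA: "C \<subseteq> A" and chain: "\<And>q r. q \<in> C \<Longrightarrow> r \<in> C \<Longrightarrow> P q r \<or> P r q"
      by (auto simp: Chains_def relation_of_def)
    show "\<exists>u\<in>A. \<forall>q\<in>C. P q u"
    proof (cases "C = {}")
      case True
      then show ?thesis using p by (auto simp: A_def)
    next
      case False
      define u where "u x = Inf ((\<lambda>q. q x) ` C)" for x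
      have bd: "bdd_below ((\<lambda>q. q x) ` C)" for x
      proof (rule bdd_belowI)
        fix y assume "y \<in> (\<lambda>q. q x) ` C"
        then obtain q where q: "q \<in> A" "y = q x" using CA by auto
        then have "- q (- x) \<le> y" "q (- x) \<le> p (- x)" using sublinear_lower by (auto simp: A_def)
        then show "- p (- x) \<le> y" by linarith
      qed
      have "sublinear u" unfolding u_def
      proof (rule sublinear_Inf)
        fix x y s t assume "s \<in> (\<lambda>q. q x) ` C" "t \<in> (\<lambda>q. q y) ` C"
        then obtain q r where qr: "q \<in> C" "r \<in> C" "s = q x" "t = r y" by auto
        then obtain m where m: "m \<in> C" "P q m" "P r m" using chain[of q r] by (auto simp: P_def)
        then have "m (x + y) \<le> s + t"
          using sublinear_add[of m x y] CA qr by (force simp: A_def P_def intro: add_mono order_trans)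
        then show "\<exists>w\<in>(\<lambda>q. q (x + y)) ` C. w \<le> s + t" using m by blast
      next
        fix x s and t :: real assume "s \<in> (\<lambda>q. q x) ` C" "t > 0"
        then show "t * s \<in> (\<lambda>q. q (t *\<^sub>R x)) ` C"
          using CA by (auto simp: A_def subset_iff sublinear_scaleR intro!: image_eqI)
      qed (use False bd in auto)
      moreover have Pu: "u x \<le> q x" if "q \<in> C" for q x
        unfolding u_def using that by (intro cInf_lower bd) auto
      moreover have "u x \<le> p x" for x
        using False CA Pu by (force simp: A_def intro: order_trans)
      ultimately show ?thesis by (auto simp: A_def P_def)
    qed
  qed
  then obtain m where m: "m \<in> A" and min: "\<And>q. q \<in> A \<Longrightarrow> (\<And>x. q x \<le> m x) \<Longrightarrow> q = m"
    by (auto simp: P_def)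
  then have sm: "sublinear m" and mp: "\<And>x. m x \<le> p x" by (auto simp: A_def)
  \<comment> \<open>Moving in the direction \<open>y\<close> gives the smaller sublinear functional
    \<open>x \<mapsto> inf (m (x + t y) - t m y)\<close>; minimality makes it equal to \<open>m\<close>, and \<open>t = 1\<close> gives
    superadditivity.\<close>
  have "m x + m y \<le> m (x + y)" for x y
  proof -
    define X where "X x = (\<lambda>t. m (x + t *\<^sub>R y) - t * m y) ` {0..}" for x
    have bd: "bdd_below (X x)" for x
    proof (rule bdd_belowI)
      fix s assume "s \<in> X x"
      then obtain t where t: "t \<ge> 0" "s = m (x + t *\<^sub>R y) - t * m y" by (auto simp: X_def)
      have "m (t *\<^sub>R y) = t * m y" using t sublinear_scaleR[OF sm] sublinear_0[OF sm] by (cases "t = 0") auto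
      moreover have "m (t *\<^sub>R y) \<le> m (x + t *\<^sub>R y) + m (- x)"
        using sublinear_add[OF sm, of "x + t *\<^sub>R y" "- x"] by simp
      ultimately show "- m (- x) \<le> s" using t by simp
    qed
    define q where "q x = Inf (X x)" for x
    have le: "q x \<le> m (x + t *\<^sub>R y) - t * m y" if "t \<ge> 0" for x t
      unfolding q_def using that by (intro cInf_lower bd) (auto simp: X_def)
    have "sublinear q" unfolding q_def
    proof (rule sublinear_Inf)
      fix x x' s s' assume "s \<in> X x" "s' \<in> X x'"
      then obtain t t' where t: "t \<ge> 0" "s = m (x + t *\<^sub>R y) - t * m y"
        "t' \<ge> 0" "s' = m (x' + t' *\<^sub>R y) - t' * m y" by (auto simp: X_def)
      have "m (x + x' + (t + t') *\<^sub>R y) \<le> m (x + t *\<^sub>R y) + m (x' + t' *\<^sub>R y)"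
        using sublinear_add[OF sm, of "x + t *\<^sub>R y" "x' + t' *\<^sub>R y"] by (simp add: algebra_simps)
      then have "m (x + x' + (t + t') *\<^sub>R y) - (t + t') * m y \<le> s + s'"
        using t by (simp add: algebra_simps)
      moreover have "m (x + x' + (t + t') *\<^sub>R y) - (t + t') * m y \<in> X (x + x')"
        unfolding X_def using t by (intro image_eqI[of _ _ "t + t'"]) auto
      ultimately show "\<exists>u\<in>X (x + x'). u \<le> s + s'" by blast
    next
      fix x s and r :: real assume "s \<in> X x" and r: "r > 0"
      then obtain t where t: "t \<ge> 0" "s = m (x + t *\<^sub>R y) - t * m y" by (auto simp: X_def)
      have "r * s = m (r *\<^sub>R x + (r * t) *\<^sub>R y) - (r * t) * m y"
        unfolding t(2) using sublinear_scaleR[OF sm r, of "x + t *\<^sub>R y"] by (simp add: algebra_simps)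
      then show "r * s \<in> X (r *\<^sub>R x)"
        unfolding X_def using t r by (intro image_eqI[of _ _ "r * t"]) auto
    qed (use bd in \<open>auto simp: X_def\<close>)
    moreover have qm: "q x \<le> m x" for x using le[of 0 x] by simp
    ultimately have "q = m" using mp by (intro min) (auto simp: A_def intro: order_trans)
    then show ?thesis using le[of 1 x] by simp
  qed
  then have add: "m (x + y) = m x + m y" for x y
    using sublinear_add[OF sm, of x y] by (intro antisym) auto
  have neg: "m (- x) = - m x" for x
    using add[of x "- x"] sublinear_0[OF sm] by simp
  have "m (t *\<^sub>R x) = t *\<^sub>R m x" for t x
  proof (cases t "0 :: real" rule: linorder_cases)
    case less
    then show ?thesis using sublinear_scaleR[OF sm, of "- t" x] neg by simp
  qed (use sublinear_0[OF sm] sublinear_scaleR[OF sm] in auto)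
  with add have "linear m" by (intro linearI)
  then show ?thesis using mp that by blast
qed

section \<open>Positive functionals above a decreasing sequence\<close>

definition positive_functional :: "'a :: cstar_algebra cdual \<Rightarrow> bool" where
  "positive_functional f \<longleftrightarrow>
     (\<forall>x. nonneg_elt x \<longrightarrow> Im (cdual_apply f x) = 0 \<and> 0 \<le> Re (cdual_apply f x))"

text \<open>A complex functional is determined by its real part.\<close>

lemma cdual_of_real_functional:
  fixes \<phi> :: "'a :: cstar_algebra \<Rightarrow> real"
  assumes lin: "linear \<phi>" and bd: "\<And>x. \<phi> x \<le> norm x"
  obtains f where "\<And>x. cdual_apply f x = Complex (\<phi> x) (- \<phi> (\<i> *\<^sub>C x))"
proof -
  have abs: "\<bar>\<phi> x\<bar> \<le> norm x" for x
    using bd[of x] bd[of "- x"] by (simp add: linear_neg[OF lin])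
  define F where "F x = Complex (\<phi> x) (- \<phi> (\<i> *\<^sub>C x))" for x
  have ii: "\<i> *\<^sub>C \<i> *\<^sub>C x = - x" for x :: 'a
    using scaleR_scaleC[of "-1" x] by (simp add: scaleC_scaleC)
  have iR: "\<i> *\<^sub>C r *\<^sub>R x = r *\<^sub>R \<i> *\<^sub>C x" for r and x :: 'a
    by (simp add: scaleR_scaleC scaleC_scaleC mult.commute)
  have cx: "c *\<^sub>C x = Re c *\<^sub>R x + Im c *\<^sub>R \<i> *\<^sub>C x" for c and x :: 'a
    unfolding scaleR_scaleC scaleC_scaleC scaleC_add_left[symmetric]
    by (simp add: complex_eq[symmetric] mult.commute)
  have "bounded_clinear F"
  proof (rule bounded_clinearI)
    show "F (x + y) = F x + F y" for x y
      by (simp add: F_def scaleC_add_right linear_add[OF lin] complex_eq_iff)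
    show "F (c *\<^sub>C x) = c * F x" for c x
      by (simp add: F_def cx[of c] scaleC_add_right iR ii linear_add[OF lin] linear_cmul[OF lin]
          linear_neg[OF lin] linear_diff[OF lin] complex_eq_iff)
    show "cmod (F x) \<le> 2 * norm x" for x
      using cmod_le[of "F x"] abs[of x] abs[of "\<i> *\<^sub>C x"] by (simp add: F_def norm_scaleC)
  qed
  then show ?thesis using that[of "Abs_cdual F"] by (simp add: Abs_cdual_inverse F_def)
qed

text \<open>This takes the place of weak* compactness of the state space (Dini's theorem): a decreasing
  sequence of positive elements that does not tend to 0 in norm is bounded below by a single
  positive functional. The functional is obtained from the Hahn-Banach theorem applied to
  \<open>p x = inf (s - l \<delta>)\<close>, where \<open>s\<close> and \<open>l \<ge> 0\<close> range over the numbers with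
  \<open>re x + l h n \<le> s\<close> for some \<open>n\<close>. Taking \<open>l = 0\<close> shows that a functional below \<open>p\<close> is positive,
  and \<open>l = 1\<close> with \<open>x = - h n\<close> gives the lower bound \<open>\<delta>\<close>. Finiteness of \<open>p\<close> is where
  \<open>\<delta> \<le> \<parallel>h n\<parallel>\<close> enters.\<close>

lemma positive_functional_above:
  fixes h :: "nat \<Rightarrow> 'a :: cstar_algebra"
  assumes pos: "\<And>n. nonneg_elt (h n)" and dec: "\<And>m n. m \<le> n \<Longrightarrow> nonneg_elt (h m - h n)"
    and low: "\<And>n. \<delta> \<le> norm (h n)"
  obtains f where "positive_functional f" "\<And>n. \<delta> \<le> Re (cdual_apply f (h n))"
proof -
  define re where "re x = (1/2) *\<^sub>R (x + star x)" for x :: 'a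
  have re_sa: "star (re x) = re x" for x by (simp add: re_def star_simps add.commute)
  have re_id: "re x = x" if "star x = x" for x using that by (simp add: re_def flip: scaleR_2)
  have re_add: "re (x + y) = re x + re y" for x y by (simp add: re_def star_simps algebra_simps)
  have re_scale: "re (t *\<^sub>R x) = t *\<^sub>R re x" for x t by (simp add: re_def star_simps algebra_simps)
  have re_norm: "norm (re x) \<le> norm x" for x
    using norm_triangle_ineq[of x "star x"] by (simp add: re_def norm_star)
  define X where "X x = {t. \<exists>n l. 0 \<le> l \<and> nonneg_elt ((t + l * \<delta>) *\<^sub>R 1 - re x - l *\<^sub>R h n)}" for x
  have XI: "t \<in> X x" if "0 \<le> l" "nonneg_elt ((t + l * \<delta>) *\<^sub>R 1 - re x - l *\<^sub>R h n)" for t x l n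
    using that by (auto simp: X_def)
  have mem: "norm x \<in> X x" for x
  proof (rule XI[of 0])
    have "nonneg_elt (norm x *\<^sub>R 1 - re x)" using re_sa re_norm by (rule nonneg_elt_sub_norm)
    then show "nonneg_elt ((norm x + 0 * \<delta>) *\<^sub>R 1 - re x - 0 *\<^sub>R h 0)" by simp
  qed simp
  have bdX: "bdd_below (X x)" for x
  proof (rule bdd_belowI)
    fix t assume "t \<in> X x"
    then obtain n l where l: "0 \<le> l" and nn: "nonneg_elt ((t + l * \<delta>) *\<^sub>R 1 - re x - l *\<^sub>R h n)"
      by (auto simp: X_def)
    have "nonneg_elt (norm x *\<^sub>R 1 - re (- x))"
      using nonneg_elt_sub_norm[OF re_sa, of "- x" "norm x"] re_norm[of "- x"] by simp
    then have "nonneg_elt (norm x *\<^sub>R 1 + re x)" using re_scale[of "-1" x] by simp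
    from nonneg_elt_add[OF nn this] have nn': "nonneg_elt ((t + l * \<delta> + norm x) *\<^sub>R 1 - l *\<^sub>R h n)"
      by (simp add: algebra_simps)
    have lh: "nonneg_elt (l *\<^sub>R h n)" using pos l by (intro nonneg_elt_scaleR)
    have s: "nonneg_elt ((t + l * \<delta> + norm x) *\<^sub>R (1 :: 'a))" using nonneg_elt_add[OF nn' lh] by simp
    have t0: "0 \<le> t + l * \<delta> + norm x"
    proof (rule ccontr)
      assume neg: "\<not> 0 \<le> t + l * \<delta> + norm x"
      then have "nonneg_elt ((- (t + l * \<delta> + norm x)) *\<^sub>R (1 :: 'a))"
        by (intro nonneg_elt_scaleR nonneg_elt_1) simp
      then have "nonneg_elt (- ((t + l * \<delta> + norm x) *\<^sub>R (1 :: 'a)))"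
        by (simp only: scaleR_minus_left)
      with nonneg_elt_antisym[OF s] neg show False by simp
    qed
    have "norm (l *\<^sub>R h n) \<le> t + l * \<delta> + norm x"
      using norm_le_of_nonneg_elt[OF lh nn'] t0 by simp
    moreover have "l * \<delta> \<le> norm (l *\<^sub>R h n)" using low l by (simp add: mult_left_mono)
    ultimately show "- norm x \<le> t" by simp
  qed
  define p where "p x = Inf (X x)" for x
  have "sublinear p" unfolding p_def
  proof (rule sublinear_Inf)
    show "X x \<noteq> {}" for x using mem by blast
    fix x y s t assume "s \<in> X x" "t \<in> X y"
    then obtain m n k l where kl: "0 \<le> k" "0 \<le> l"
      and nn: "nonneg_elt ((s + k * \<delta>) *\<^sub>R 1 - re x - k *\<^sub>R h m)"
        "nonneg_elt ((t + l * \<delta>) *\<^sub>R 1 - re y - l *\<^sub>R h n)"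
      by (auto simp: X_def)
    \<comment> \<open>As \<open>h\<close> decreases, both inequalities persist for the larger of the two indices.\<close>
    have "nonneg_elt (((s + k * \<delta>) *\<^sub>R 1 - re x - k *\<^sub>R h m) + ((t + l * \<delta>) *\<^sub>R 1 - re y - l *\<^sub>R h n)
      + k *\<^sub>R (h m - h (max m n)) + l *\<^sub>R (h n - h (max m n)))"
      by (intro nonneg_elt_add nonneg_elt_scaleR nn dec kl) auto
    then have "nonneg_elt ((s + t + (k + l) * \<delta>) *\<^sub>R 1 - re (x + y) - (k + l) *\<^sub>R h (max m n))"
      by (simp add: re_add algebra_simps)
    then have "s + t \<in> X (x + y)" using kl by (intro XI) auto
    then show "\<exists>u\<in>X (x + y). u \<le> s + t" by blast
  next
    fix x s and t :: real assume "s \<in> X x" and t: "t > 0"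
    then obtain n l where l: "0 \<le> l" and nn: "nonneg_elt ((s + l * \<delta>) *\<^sub>R 1 - re x - l *\<^sub>R h n)"
      by (auto simp: X_def)
    from nonneg_elt_scaleR[OF nn, of t]
    have "nonneg_elt ((t * s + (t * l) * \<delta>) *\<^sub>R 1 - re (t *\<^sub>R x) - (t * l) *\<^sub>R h n)"
      using t by (simp add: re_scale algebra_simps)
    then show "t * s \<in> X (t *\<^sub>R x)" using t l by (intro XI) auto
  qed (rule bdX)
  then obtain \<phi> where \<phi>: "linear \<phi>" "\<And>x. \<phi> x \<le> p x" by (rule hahn_banach_sublinear) blast
  have le: "\<phi> x \<le> t" if "t \<in> X x" for x t
    using \<phi>(2)[of x] cInf_lower[OF that bdX] by (simp add: p_def)
  obtain f where f: "\<And>x. cdual_apply f x = Complex (\<phi> x) (- \<phi> (\<i> *\<^sub>C x))"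
    using cdual_of_real_functional[OF \<phi>(1)] le[OF mem] by blast
  have skew: "\<phi> x \<le> 0" if "re x = 0" for x
    using le[OF XI[of 0 0 x 0]] that by simp
  have "positive_functional f" unfolding positive_functional_def f
  proof (intro allI impI)
    fix x :: 'a assume x: "nonneg_elt x"
    have r0: "re (\<i> *\<^sub>C x) = 0" using x by (simp add: re_def star_scaleC nonneg_elt_star scaleC_minus_left)
    then have "\<phi> (\<i> *\<^sub>C x) = 0"
      using skew[of "\<i> *\<^sub>C x"] skew[of "- (\<i> *\<^sub>C x)"] re_scale[of "-1" "\<i> *\<^sub>C x"]
      by (simp add: linear_neg[OF \<phi>(1)])
    moreover have "re (- x) = - x" using x by (intro re_id) (simp add: nonneg_elt_star)
    then have "\<phi> (- x) \<le> 0" using le[OF XI[of 0 0 "- x" 0]] x by simp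
    ultimately show "Im (Complex (\<phi> x) (- \<phi> (\<i> *\<^sub>C x))) = 0 \<and> 0 \<le> Re (Complex (\<phi> x) (- \<phi> (\<i> *\<^sub>C x)))"
      by (simp add: linear_neg[OF \<phi>(1)])
  qed
  moreover have "\<delta> \<le> Re (cdual_apply f (h n))" for n
  proof -
    have "re (- h n) = - h n" by (intro re_id) (simp add: nonneg_elt_star pos)
    then have "\<phi> (- h n) \<le> - \<delta>" by (intro le[OF XI[of 1 _ _ n]]) simp_all
    then show ?thesis by (simp add: f linear_neg[OF \<phi>(1)])
  qed
  ultimately show ?thesis by (rule that)
qed

section \<open>Exact interpolation in a convex semigroup of contractions\<close>

lemma convex_combination_square:
  fixes u v c :: "'a :: cstar_algebra" and t :: real
  defines "w \<equiv> (1 - t) *\<^sub>R u + t *\<^sub>R v"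
  shows "(1 - t) *\<^sub>R (star u * c * u) + t *\<^sub>R (star v * c * v) - star w * c * w
    = (t * (1 - t)) *\<^sub>R (star (u - v) * c * (u - v))"
  unfolding w_def by (simp add: star_simps algebra_simps)

lemma nonneg_elt_sub_conj_contraction:
  fixes c g :: "'a :: cstar_algebra"
  assumes c: "nonneg_elt c" and g: "norm g \<le> 1" and cg: "c * g = g * c"
  shows "nonneg_elt (c - star g * c * g)"
proof -
  obtain s where s: "nonneg_elt s" "s * s = c" "\<And>y. y * c = c * y \<Longrightarrow> y * s = s * y"
    using nonneg_elt_sqrt[OF c] by blast
  note ss = nonneg_elt_star[OF s(1)]
  have gs: "s * g = g * s" using s(3)[of g] cg by simp
  have gs': "s * star g = star g * s" using star_commute[OF ss gs] .
  have "norm (star g * g) \<le> 1" using g by (simp add: norm_star_mult_self power_le_one)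
  then have "nonneg_elt (1 *\<^sub>R 1 - star g * g)"
    by (intro nonneg_elt_sub_norm) (simp_all add: star_simps)
  then have "nonneg_elt (star s * (1 - star g * g) * s)" by (intro nonneg_elt_conj) simp
  also have "star s * (1 - star g * g) * s = s * s - (s * star g) * (g * s)"
    by (simp add: ss algebra_simps)
  also have "\<dots> = c - star g * c * g"
    unfolding gs' gs[symmetric] s(2)[symmetric] by (simp add: mult.assoc)
  finally show ?thesis .
qed

text \<open>The element \<open>z\<close> is the positive part of \<open>c - 1\<close> and measures where \<open>c\<close> exceeds 1. The
  last assumption says that elements of \<open>S\<close> can be made small there. The aim is an element
  \<open>g\<close> of \<open>S\<close> with \<open>g* c g \<le> 1\<close>; since \<open>c\<close> commutes with \<open>S\<close>, one may think of \<open>S\<close> and \<open>c\<close>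
  fibrewise over the spectrum of \<open>c\<close>.\<close>

locale contraction_semigroup =
  fixes S :: "'a :: cstar_algebra set" and c z z' :: 'a
  assumes contraction: "g \<in> S \<Longrightarrow> norm g \<le> 1"
    and mult_closed: "g \<in> S \<Longrightarrow> h \<in> S \<Longrightarrow> g * h \<in> S"
    and convex_S: "convex S" and closed_S: "closed S" and one_in_S: "1 \<in> S"
    and commutes: "g \<in> S \<Longrightarrow> c * g = g * c"
    and c_nonneg: "nonneg_elt c" and z_nonneg: "nonneg_elt z" and z'_nonneg: "nonneg_elt z'"
    and c_split: "c - 1 = z - z'"
    and z_commutes: "y * c = c * y \<Longrightarrow> y * z = z * y"
    and z'_commutes: "y * c = c * y \<Longrightarrow> y * z' = z' * y"
    and small: "e > 0 \<Longrightarrow> \<exists>k\<in>S. norm (z * z * k) \<le> e"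
begin

text \<open>One step improves the excess from \<open>e\<close> to \<open>3/4 e\<close> and moves \<open>g\<close> by at most \<open>2 e\<close>.
  Replace \<open>g\<close> by \<open>h = (1 - t) g + t g k\<close> with \<open>t = e / (1 + e)\<close> and \<open>k\<close> small where \<open>z\<close> is not.
  By operator convexity \<open>h* c h \<le> (1 - t) U + t V\<close> with \<open>U = g* c g\<close> and \<open>V = (g k)* c (g k)\<close>.
  The commuting weights \<open>\<alpha> = z\<^sup>2 / (z\<^sup>2 + e\<^sup>2)\<close> and \<open>\<beta> = 1 - \<alpha>\<close> separate two regions. Where
  \<open>\<alpha>\<close> dominates, \<open>U \<le> 1 + e\<close> is multiplied by \<open>1 - t = 1 / (1 + e)\<close> and \<open>\<alpha> V\<close> is negligible.
  Where \<open>\<beta>\<close> dominates, both \<open>U\<close> and \<open>V\<close> are at most \<open>c\<close>, and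
  \<open>\<beta> (c - 1) \<le> \<beta> z = e\<^sup>2 z / (z\<^sup>2 + e\<^sup>2) \<le> e / 2\<close>.
  No estimate by norms alone could do this: without the separation the factor \<open>1 - t\<close> is the only
  gain, and summable displacements would leave a positive excess.\<close>

lemma improve:
  assumes g: "g \<in> S" "nonneg_elt ((1 + e) *\<^sub>R 1 - star g * c * g)" and e: "e > 0"
  obtains h where "h \<in> S" "nonneg_elt ((1 + 3/4 * e) *\<^sub>R 1 - star h * c * h)" "norm (h - g) \<le> 2 * e"
proof -
  define t where "t = e / (1 + e)"
  have t: "0 < t" "t < 1" "t \<le> e" "(1 - t) * (1 + e) = 1"
    using e by (simp_all add: t_def field_simps)
  note sz = nonneg_elt_star[OF z_nonneg] and sc = nonneg_elt_star[OF c_nonneg]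
  note zz = nonneg_elt_square[OF sz]
  obtain j where j: "nonneg_elt j" "j * (z * z + e\<^sup>2 *\<^sub>R 1) = 1" "(z * z + e\<^sup>2 *\<^sub>R 1) * j = 1"
    "\<And>y. y * (z * z) = (z * z) * y \<Longrightarrow> y * j = j * y"
    using nonneg_elt_inverse_shift[OF zz, of "e\<^sup>2"] e by auto
  have jc: "y * j = j * y" if "y * c = c * y" for y
    by (rule j(4)) (metis z_commutes[OF that] mult.assoc)
  define \<beta> where "\<beta> = e\<^sup>2 *\<^sub>R j"
  define \<alpha> where "\<alpha> = j * (z * z)"
  have \<beta>: "nonneg_elt \<beta>" unfolding \<beta>_def by (intro nonneg_elt_scaleR j) simp
  have zzj: "(z * z) * j = j * (z * z)" by (rule j(4)) simp
  have \<alpha>: "nonneg_elt \<alpha>" unfolding \<alpha>_def by (rule nonneg_elt_mult[OF j(1) zz zzj[symmetric]])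
  have ab: "\<alpha> + \<beta> = 1" using j(2) by (simp add: \<alpha>_def \<beta>_def distrib_left)
  have \<beta>c: "y * \<beta> = \<beta> * y" if "y * c = c * y" for y using jc[OF that] by (simp add: \<beta>_def)
  have \<alpha>c: "y * \<alpha> = \<alpha> * y" if "y * c = c * y" for y
    using \<beta>c[OF that] ab by (metis add_diff_cancel_right' left_diff_distrib mult_1_left mult_1_right right_diff_distrib)
  \<comment> \<open>Chosen so that \<open>\<parallel>\<alpha> V\<parallel> \<le> \<parallel>j\<parallel> \<parallel>z\<^sup>2 k\<parallel> \<parallel>c\<parallel> \<le> e / 4\<close>.\<close>
  define \<epsilon> where "\<epsilon> = e / 4 / (1 + norm j * norm c)"
  have den: "1 + norm j * norm c > 0" by (simp add: add_pos_nonneg)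
  then have "\<epsilon> > 0" using e by (simp add: \<epsilon>_def)
  then obtain k where k: "k \<in> S" "norm (z * z * k) \<le> \<epsilon>" using small by blast
  define v where "v = g * k"
  define h where "h = (1 - t) *\<^sub>R g + t *\<^sub>R v"
  have v: "v \<in> S" unfolding v_def by (rule mult_closed[OF g(1) k(1)])
  have h: "h \<in> S" unfolding h_def using convexD_alt[OF convex_S g(1) v, of t] t by simp
  define U where "U = star g * c * g"
  define V where "V = star v * c * v"
  define W where "W = star h * c * h"
  have cstar: "c * star y = star y * c" if "y \<in> S" for y
    using star_commute[OF sc commutes[OF that]] .
  have comm: "star y * c * y * c = c * (star y * c * y)" if "y \<in> S" for y
    using cstar[OF that] commutes[OF that] by (metis mult.assoc)
  note Uc = comm[OF g(1), folded U_def] and Vc = comm[OF v, folded V_def]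
  have Us: "star U = U" and Vs: "star V = V" by (simp_all add: U_def V_def star_simps sc mult.assoc)
  have cc: "x * c = c * x \<Longrightarrow> y * c = c * y \<Longrightarrow> (x - y) * c = c * (x - y)" for x y
    by (simp add: algebra_simps)
  have T1: "nonneg_elt (\<beta> * (c - U))"
    using nonneg_elt_sub_conj_contraction[OF c_nonneg contraction commutes, OF g(1) g(1)]
    by (intro nonneg_elt_mult \<beta> \<beta>c[symmetric] cc Uc) (simp_all add: U_def)
  have T3: "nonneg_elt (\<beta> * (c - V))"
    using nonneg_elt_sub_conj_contraction[OF c_nonneg contraction commutes, OF v v]
    by (intro nonneg_elt_mult \<beta> \<beta>c[symmetric] cc Vc) (simp_all add: V_def)
  have T2: "nonneg_elt (\<alpha> * ((1 + e) *\<^sub>R 1 - U))"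
    using g(2) by (intro nonneg_elt_mult \<alpha> \<alpha>c[symmetric] cc Uc) (simp_all add: U_def)
  have T4: "nonneg_elt ((e / 4) *\<^sub>R 1 - \<alpha> * V)"
  proof (rule nonneg_elt_sub_norm)
    show "star (\<alpha> * V) = \<alpha> * V"
      using \<alpha>c[OF Vc] by (simp add: star_mult Vs nonneg_elt_star[OF \<alpha>])
    have kz: "k * z = z * k" using z_commutes[of k] commutes[OF k(1)] by simp
    have gz: "g * z = z * g" using z_commutes[of g] commutes[OF g(1)] by simp
    have kz': "star k * z = z * star k" using star_commute[OF sz kz[symmetric]] by simp
    have "\<alpha> * V = j * (z * z * star k) * (star g * c * v)"
      by (simp add: \<alpha>_def V_def v_def star_mult mult.assoc)
    also have "z * z * star k = star (z * z * k)"
      by (simp add: star_mult sz mult.assoc) (metis kz' mult.assoc)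
    finally have "norm (\<alpha> * V) \<le> norm (j * star (z * z * k)) * norm (star g * c * v)"
      using norm_mult_ineq by metis
    also have "\<dots> \<le> (norm j * \<epsilon>) * (norm c)"
    proof (rule mult_mono)
      show "norm (j * star (z * z * k)) \<le> norm j * \<epsilon>"
        using norm_mult_ineq[of j "star (z * z * k)"] k(2)
        by (simp add: norm_star) (meson mult_left_mono norm_ge_zero order_trans)
      have "norm (star g * c * v) \<le> norm (star g * c) * norm v" by (rule norm_mult_ineq)
      also have "\<dots> \<le> norm (star g) * norm c * norm v" by (intro mult_right_mono norm_mult_ineq) simp
      also have "\<dots> \<le> 1 * norm c * 1"
        using contraction[OF g(1)] contraction[OF v] by (intro mult_mono) (simp_all add: norm_star)
      finally show "norm (star g * c * v) \<le> norm c" by simp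
    qed (use \<open>\<epsilon> > 0\<close> in auto)
    also have "\<dots> = e / 4 * (norm j * norm c / (1 + norm j * norm c))" by (simp add: \<epsilon>_def)
    also have "\<dots> \<le> e / 4 * 1" using e den by (intro mult_left_mono) (simp_all add: field_simps)
    finally show "norm (\<alpha> * V) \<le> e / 4" by simp
  qed
  have T5: "nonneg_elt ((e / 2) *\<^sub>R 1 - \<beta> * z)"
  proof -
    have zj: "z * j = j * z" by (rule j(4)) (simp add: mult.assoc)
    \<comment> \<open>This is \<open>0 \<le> (z - e)\<^sup>2\<close> divided by \<open>z\<^sup>2 + e\<^sup>2\<close>.\<close>
    have "nonneg_elt ((e / 2) *\<^sub>R (j * ((z - e *\<^sub>R 1) * (z - e *\<^sub>R 1))))"
      by (intro nonneg_elt_scaleR nonneg_elt_mult[OF j(1) nonneg_elt_square])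
        (use e zj zzj in \<open>simp_all add: star_simps sz algebra_simps\<close>)
    also have "(e / 2) *\<^sub>R (j * ((z - e *\<^sub>R 1) * (z - e *\<^sub>R 1))) =
        (e / 2) *\<^sub>R (j * (z * z + e\<^sup>2 *\<^sub>R 1)) - \<beta> * z"
      by (simp add: \<beta>_def algebra_simps power2_eq_square) (simp add: scaleR_add_left[symmetric])
    finally show ?thesis by (simp add: j(2))
  qed
  have T6: "nonneg_elt (\<beta> * z')"
    by (intro nonneg_elt_mult \<beta> z'_nonneg \<beta>c[symmetric] z'_commutes[symmetric]) (rule refl)
  have T7: "nonneg_elt ((1 - t) *\<^sub>R U + t *\<^sub>R V - W)"
    unfolding U_def V_def W_def h_def convex_combination_square
    by (intro nonneg_elt_scaleR nonneg_elt_conj c_nonneg) (use t in auto)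
  have "nonneg_elt ((1 - t) *\<^sub>R (\<beta> * (c - U)) + (1 - t) *\<^sub>R (\<alpha> * ((1 + e) *\<^sub>R 1 - U)) + t *\<^sub>R (\<beta> * (c - V))
      + t *\<^sub>R ((e / 4) *\<^sub>R 1 - \<alpha> * V) + ((e / 2) *\<^sub>R 1 - \<beta> * z) + \<beta> * z'
      + ((1 - t) *\<^sub>R U + t *\<^sub>R V - W) + ((1 - t) * (e / 4)) *\<^sub>R 1)"
    by (intro nonneg_elt_add nonneg_elt_scaleR nonneg_elt_1 T1 T2 T3 T4 T5 T6 T7) (use t e in auto)
  also have "\<dots> = (1 + 3/4 * e) *\<^sub>R 1 - W"
  proof -
    have a: "\<alpha> = 1 - \<beta>" using ab by (simp add: eq_diff_eq)
    have c: "c = 1 + z - z'" using c_split by (simp add: algebra_simps)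
    have "(1 - t) *\<^sub>R (\<alpha> * ((1 + e) *\<^sub>R 1 - U)) = \<alpha> - (1 - t) *\<^sub>R (\<alpha> * U)"
      using t(4) by (simp add: right_diff_distrib scaleR_diff_right)
    then show ?thesis
      by (simp only:) (simp add: a c algebra_simps, simp add: diff_divide_distrib flip: scaleR_add_left)
  qed
  finally have "nonneg_elt ((1 + 3/4 * e) *\<^sub>R 1 - star h * c * h)" by (simp add: W_def)
  moreover have "norm (h - g) \<le> 2 * e"
  proof -
    have "h - g = t *\<^sub>R (v - g)" by (simp add: h_def algebra_simps)
    then have "norm (h - g) = t * norm (v - g)" using t by simp
    also have "\<dots> \<le> t * 2"
      using norm_triangle_ineq4[of v g] contraction[OF g(1)] contraction[OF v] t
      by (intro mult_left_mono) auto
    finally show ?thesis using t by simp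
  qed
  ultimately show ?thesis using that h by blast
qed

text \<open>The improvements start at \<open>g = 1\<close>, where \<open>c\<close> exceeds 1 by at most \<open>\<parallel>c\<parallel>\<close>, and form a
  Cauchy sequence because the excesses decay geometrically.\<close>

lemma exact_interpolation:
  obtains g where "g \<in> S" "nonneg_elt (1 - star g * c * g)"
proof -
  define e where "e n = (1 + norm c) * (3/4) ^ n" for n :: nat
  have e: "e n > 0" for n by (simp add: e_def add_pos_nonneg)
  have "\<exists>x. \<forall>n. (x n \<in> S \<and> nonneg_elt ((1 + e n) *\<^sub>R 1 - star (x n) * c * x n))
      \<and> norm (x (Suc n) - x n) \<le> 2 * e n"
  proof (rule dependent_nat_choice)
    have "nonneg_elt ((1 + e 0) *\<^sub>R 1 - c)"
      by (intro nonneg_elt_sub_norm nonneg_elt_star c_nonneg) (simp add: e_def)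
    then show "\<exists>x. x \<in> S \<and> nonneg_elt ((1 + e 0) *\<^sub>R 1 - star x * c * x)"
      using one_in_S by (intro exI[of _ 1]) simp
    fix x n assume "x \<in> S \<and> nonneg_elt ((1 + e n) *\<^sub>R 1 - star x * c * x)"
    then obtain y where "y \<in> S" "nonneg_elt ((1 + 3/4 * e n) *\<^sub>R 1 - star y * c * y)"
      "norm (y - x) \<le> 2 * e n"
      using improve[of x "e n"] e by blast
    moreover have "3/4 * e n = e (Suc n)" by (simp add: e_def)
    ultimately show "\<exists>y. (y \<in> S \<and> nonneg_elt ((1 + e (Suc n)) *\<^sub>R 1 - star y * c * y))
        \<and> norm (y - x) \<le> 2 * e n" by auto
  qed
  then obtain x where x: "\<And>n. x n \<in> S"
    "\<And>n. nonneg_elt ((1 + e n) *\<^sub>R 1 - star (x n) * c * x n)"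
    "\<And>n. norm (x (Suc n) - x n) \<le> 2 * e n" by blast
  have se: "summable e" unfolding e_def by (intro summable_mult summable_geometric) simp
  have "summable (\<lambda>n. x (Suc n) - x n)"
    by (rule summable_comparison_test'[OF summable_mult[OF se, of 2], where N = 0]) (use x(3) in simp)
  then obtain l where "(\<lambda>n. \<Sum>i<n. x (Suc i) - x i) \<longlonglongrightarrow> l"
    using summable_LIMSEQ by blast
  then have "(\<lambda>n. x n - x 0) \<longlonglongrightarrow> l" by (simp add: sum_lessThan_telescope)
  from tendsto_add[OF this tendsto_const[of "x 0"]] have lim: "x \<longlonglongrightarrow> l + x 0" by simp
  have "l + x 0 \<in> S" using closed_sequentially[OF closed_S] x(1) lim by blast
  moreover have "(\<lambda>n. (1 + e n) *\<^sub>R 1 - star (x n) * c * x n)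
      \<longlonglongrightarrow> (1 + 0) *\<^sub>R 1 - star (l + x 0) * c * (l + x 0)"
    by (intro tendsto_intros lim bounded_linear.tendsto[OF bounded_linear_star] summable_LIMSEQ_zero se)
  then have "nonneg_elt ((1 + 0) *\<^sub>R 1 - star (l + x 0) * c * (l + x 0))"
    by (rule nonneg_elt_limit[rotated]) (rule x(2))
  ultimately show ?thesis using that by simp
qed

end

section \<open>Cesaro means of the powers of a contraction\<close>

definition cesaro :: "'a :: cstar_algebra \<Rightarrow> nat \<Rightarrow> 'a" where
  "cesaro a m = inverse (real m) *\<^sub>R (\<Sum>k<m. a ^ k)"

lemma norm_cesaro:
  assumes "norm a \<le> 1" shows "norm (cesaro a m) \<le> 1"
proof -
  have "norm (\<Sum>k<m. a ^ k) \<le> (\<Sum>k<m. 1)"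
    by (rule sum_norm_le) (meson assms norm_ge_zero norm_power_ineq order_trans power_le_one)
  then show ?thesis by (cases "m = 0") (simp_all add: cesaro_def field_simps)
qed

lemma cesaro_mem:
  assumes "convex S" "m > 0" "\<And>k. a ^ k \<in> S" shows "cesaro a m \<in> S"
proof -
  have "(\<Sum>k<m. inverse (real m) *\<^sub>R a ^ k) \<in> S"
    by (rule convex_sum) (use assms in auto)
  then show ?thesis by (simp add: cesaro_def scaleR_sum_right)
qed

lemma cesaro_one_minus:
  assumes "norm a \<le> 1"
  shows "norm ((1 - a) * cesaro a m) \<le> 2 * inverse (real m)"
    and "norm (cesaro a m * (1 - a)) \<le> 2 * inverse (real m)"
proof -
  have tel: "(\<Sum>k<m. a ^ k) * (1 - a) = 1 - a ^ m" "(1 - a) * (\<Sum>k<m. a ^ k) = 1 - a ^ m"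
  proof (induction m)
    case (Suc m)
    have "a ^ m * (1 - a) = a ^ m - a ^ Suc m" "(1 - a) * a ^ m = a ^ m - a ^ Suc m"
      by (simp_all add: algebra_simps power_commutes)
    with Suc show "(\<Sum>k<Suc m. a ^ k) * (1 - a) = 1 - a ^ Suc m"
      "(1 - a) * (\<Sum>k<Suc m. a ^ k) = 1 - a ^ Suc m"
      by (simp_all only: sum.lessThan_Suc distrib_left distrib_right) simp_all
  qed simp_all
  have "norm (a ^ m) \<le> 1" by (meson assms norm_ge_zero norm_power_ineq order_trans power_le_one)
  then have "norm (1 - a ^ m) \<le> 2" using norm_triangle_ineq4[of 1 "a ^ m"] by simp
  then show "norm ((1 - a) * cesaro a m) \<le> 2 * inverse (real m)"
    "norm (cesaro a m * (1 - a)) \<le> 2 * inverse (real m)"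
    by (simp_all add: cesaro_def tel divide_simps)
qed

text \<open>A contraction almost fixes a vector if and only if its adjoint does. In algebraic form:
  \<open>(1 - a) (1 - a)* \<le> (1 - a) + (1 - a)*\<close>, so smallness of \<open>(1 - a) g\<close> controls \<open>(1 - a*) g\<close>.\<close>

lemma cesaro_one_minus_star:
  assumes a: "norm a \<le> 1"
  shows "(norm ((1 - star a) * cesaro a m))\<^sup>2 \<le> 4 * inverse (real m)"
proof -
  define g where "g = cesaro a m"
  define u where "u = star ((1 - star a) * g) * ((1 - star a) * g)"
  define v where "v = star g * ((1 - a) * g) + star (star g * ((1 - a) * g))"
  have "norm (star (star a) * star a) \<le> 1"
    using a by (simp add: norm_star_mult_self norm_star power_le_one)
  then have "nonneg_elt (1 *\<^sub>R 1 - a * star a)"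
    by (intro nonneg_elt_sub_norm) (simp_all add: star_simps)
  then have "nonneg_elt (star g * (1 - a * star a) * g)" by (intro nonneg_elt_conj) simp
  also have "star g * (1 - a * star a) * g = v - u"
    by (simp add: u_def v_def star_simps algebra_simps)
  finally have "norm u \<le> norm v"
    by (intro norm_mono_nonneg_elt) (simp_all add: u_def nonneg_elt_star_mult_self)
  also have "\<dots> \<le> 2 * norm (star g * ((1 - a) * g))"
    unfolding v_def using norm_triangle_ineq by (simp add: norm_star norm_triangle_le)
  also have "\<dots> \<le> 2 * (norm (star g) * norm ((1 - a) * g))"
    using norm_mult_ineq[of "star g" "(1 - a) * g"] by simp
  also have "\<dots> \<le> 2 * (1 * (2 * inverse (real m)))"
    using norm_cesaro[OF a, of m] cesaro_one_minus(1)[OF a, of m]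
    by (intro mult_left_mono mult_mono) (simp_all add: g_def norm_star)
  finally show ?thesis by (simp add: u_def g_def norm_star_mult_self)
qed

text \<open>The peak is approached by \<open>(a* a)^N\<close>, which need not lie in the operator algebra, whereas the
  Cesaro means do. They absorb \<open>(a* a)^N\<close> in norm, so smallness of the former passes to the latter.\<close>

lemma cesaro_asymptotically_fixed:
  fixes a :: "'a :: cstar_algebra"
  assumes a: "norm a \<le> 1"
  shows "(\<lambda>m. (star a * a) ^ N * cesaro a m - cesaro a m) \<longlonglongrightarrow> 0"
proof (induction N)
  case (Suc N)
  have inv: "(\<lambda>m. inverse (real m)) \<longlonglongrightarrow> 0"
    using LIMSEQ_inverse_real_of_nat by (subst (asm) filterlim_sequentially_Suc) simp
  have 1: "(\<lambda>m. (1 - a) * cesaro a m) \<longlonglongrightarrow> 0"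
    by (rule Lim_null_comparison[of _ "\<lambda>m. 2 * inverse (real m)"])
      (use cesaro_one_minus(1)[OF a] in simp, use tendsto_mult_right_zero[OF inv] in simp)
  have "(\<lambda>m. (norm ((1 - star a) * cesaro a m))\<^sup>2) \<longlonglongrightarrow> 0"
    by (rule Lim_null_comparison[of _ "\<lambda>m. 4 * inverse (real m)"])
      (use cesaro_one_minus_star[OF a] in simp, use tendsto_mult_right_zero[OF inv] in simp)
  then have "(\<lambda>m. sqrt ((norm ((1 - star a) * cesaro a m))\<^sup>2)) \<longlonglongrightarrow> sqrt 0"
    by (rule tendsto_real_sqrt)
  then have 2: "(\<lambda>m. (1 - star a) * cesaro a m) \<longlonglongrightarrow> 0"
    by (simp add: tendsto_norm_zero_iff)
  have "(\<lambda>m. (star a * a) * ((star a * a) ^ N * cesaro a m - cesaro a m)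
      - star a * ((1 - a) * cesaro a m) - (1 - star a) * cesaro a m) \<longlonglongrightarrow> (star a * a) * 0 - star a * 0 - 0"
    by (intro tendsto_intros Suc.IH 1 2)
  then show ?case by (simp add: algebra_simps)
qed simp

section \<open>Positivity of squares in the bidual\<close>

text \<open>The left and right translates of a functional are \<open>dual_act f y = f (y _)\<close> and
  \<open>right_act y f = f (_ y)\<close>.\<close>

abbreviation right_act :: "'a :: cstar_algebra \<Rightarrow> 'a cdual \<Rightarrow> 'a cdual" where
  "right_act y f \<equiv> bidual_act (bidual_embed y) f"

lemma right_act_apply [simp]: "cdual_apply (right_act y f) x = cdual_apply f (x * y)"
  by (simp add: bidual_act.rep_eq bidual_embed.rep_eq dual_act.rep_eq)

lemma dual_act_mult: "dual_act f (x * y) = dual_act (dual_act f x) y"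
  by (simp add: cdual_apply_inject[symmetric] fun_eq_iff dual_act.rep_eq mult.assoc)

lemma dual_act_one: "dual_act f 1 = f"
  by (simp add: cdual_apply_inject[symmetric] fun_eq_iff dual_act.rep_eq)

lemma dual_act_star: "dual_act f (star y) = dual_star (right_act y (dual_star f))"
  by (simp add: cdual_apply_inject[symmetric] fun_eq_iff dual_act.rep_eq dual_star.rep_eq star_simps)

lemma cdual_apply_simps:
  "cdual_apply f 0 = 0" "cdual_apply f (- x) = - cdual_apply f x"
  "cdual_apply f (x - y) = cdual_apply f x - cdual_apply f y"
  "cdual_apply f (r *\<^sub>R x) = of_real r * cdual_apply f x"
proof -
  show 1: "cdual_apply f (r *\<^sub>R x) = of_real r * cdual_apply f x" for r x
    by (simp add: scaleR_scaleC cdual_apply_scaleC)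
  show "cdual_apply f 0 = 0" "cdual_apply f (- x) = - cdual_apply f x"
    using 1[of 0 x] 1[of "-1" x] by simp_all
  then show "cdual_apply f (x - y) = cdual_apply f x - cdual_apply f y"
    using cdual_apply_add[of f x "- y"] 1[of "-1" y] by simp
qed

lemma bounded_linear_cdual_apply: "bounded_linear (cdual_apply f)"
  using cdual_apply[of f] by (simp add: bounded_clinear_def)

lemma cmod_le_of_rotations:
  assumes "\<And>c. cmod c = 1 \<Longrightarrow> Re (c * w) \<le> B"
  shows "cmod w \<le> B"
proof (cases "w = 0")
  case True
  then show ?thesis using assms[of 1] by simp
next
  case False
  have "cnj (sgn w) * w = of_real (cmod w)"
    using False complex_norm_square[of w] by (simp add: sgn_eq power2_eq_square divide_eq_eq mult.commute)
  then show ?thesis using assms[of "cnj (sgn w)"] False by (simp add: norm_sgn)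
qed

lemma discriminant_nonpos:
  fixes A D N :: real
  assumes "\<And>s. 0 \<le> A + 2 * s * D + s\<^sup>2 * N" "0 \<le> N"
  shows "D\<^sup>2 \<le> A * N"
proof (cases "N = 0")
  case True
  have "D = 0"
  proof (rule ccontr)
    assume "D \<noteq> 0"
    then have "2 * (- (A + 1) / (2 * D)) * D = - (A + 1)" by simp
    then show False using assms(1)[of "- (A + 1) / (2 * D)"] True by simp
  qed
  then show ?thesis using True by simp
next
  case False
  then have "N > 0" using assms(2) by simp
  have "0 \<le> N * (A + 2 * (- D / N) * D + (- D / N)\<^sup>2 * N)"
    using assms(1)[of "- D / N"] \<open>N > 0\<close> by simp
  also have "\<dots> = A * N - D\<^sup>2" using \<open>N > 0\<close> by (simp add: field_simps power2_eq_square)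
  finally show ?thesis by simp
qed

context
  fixes f :: "'a :: cstar_algebra cdual"
  assumes pos: "positive_functional f"
begin

lemma positive_functional_star: "cdual_apply f (star x) = cnj (cdual_apply f x)"
proof -
  have sa: "Im (cdual_apply f h) = 0" if "star h = h" for h
  proof -
    have "nonneg_elt (norm h *\<^sub>R 1 - h)" by (rule nonneg_elt_sub_norm) (simp_all add: that)
    then have "Im (cdual_apply f (norm h *\<^sub>R 1 - h)) = 0" "Im (cdual_apply f 1) = 0"
      using pos nonneg_elt_1 unfolding positive_functional_def by blast+
    then show ?thesis by (simp add: cdual_apply_simps)
  qed
  have i: "star (\<i> *\<^sub>C (x - star x)) = \<i> *\<^sub>C (x - star x)"
    by (simp add: star_scaleC star_simps scaleC_minus_left scaleC_diff_right)
  have "Im (cdual_apply f (x + star x)) = 0" by (rule sa) (simp add: star_simps add.commute)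
  moreover have "Im (cdual_apply f (\<i> *\<^sub>C (x - star x))) = 0" by (rule sa[OF i])
  ultimately show ?thesis
    by (simp add: cdual_apply_simps cdual_apply_add cdual_apply_scaleC complex_eq_iff)
qed

definition gns_square where "gns_square y = Re (cdual_apply f (star y * y))"

lemma gns_square_nonneg: "0 \<le> gns_square y"
  using pos nonneg_elt_star_mult_self unfolding positive_functional_def gns_square_def by blast

lemma gns_square_le: "gns_square y \<le> norm f * (norm y)\<^sup>2"
  using complex_Re_le_cmod[of "cdual_apply f (star y * y)"] cdual_apply_bound[of f "star y * y"]
  by (simp add: gns_square_def norm_star_mult_self)

lemma gns_square_scaleC: "cmod c = 1 \<Longrightarrow> gns_square (c *\<^sub>C y) = gns_square y"
  using complex_norm_square[of c]
  by (simp add: gns_square_def star_scaleC mult_scaleC_left mult_scaleC_right scaleC_scaleC cdual_apply_scaleC)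

lemma gns_square_add: "gns_square (x + s *\<^sub>R y) = gns_square x + 2 * s * Re (cdual_apply f (star y * x)) + s\<^sup>2 * gns_square y"
proof -
  have "cdual_apply f (star x * y) = cnj (cdual_apply f (star y * x))"
    using positive_functional_star[of "star y * x"] by (simp add: star_simps)
  then show ?thesis
    by (simp add: gns_square_def star_simps distrib_left distrib_right cdual_apply_add cdual_apply_simps
        power2_eq_square algebra_simps)
qed

text \<open>Up to completion, a positive functional \<open>f\<close> makes the algebra a Hilbert space with inner
  product \<open>f (y* x)\<close>.\<close>

lemma cauchy_schwarz: "cmod (cdual_apply f (star y * x)) \<le> sqrt (gns_square y) * sqrt (gns_square x)"
proof (rule cmod_le_of_rotations)
  fix c :: complex assume c: "cmod c = 1"
  have "(Re (cdual_apply f (star y * (c *\<^sub>C x))))\<^sup>2 \<le> gns_square (c *\<^sub>C x) * gns_square y"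
    using gns_square_nonneg gns_square_add[of "c *\<^sub>C x" _ y] by (intro discriminant_nonpos) metis
  then have "(Re (c * cdual_apply f (star y * x)))\<^sup>2 \<le> (sqrt (gns_square y) * sqrt (gns_square x))\<^sup>2"
    using gns_square_nonneg c
    by (simp add: gns_square_scaleC mult_scaleC_right cdual_apply_scaleC power_mult_distrib mult.commute)
  then show "Re (c * cdual_apply f (star y * x)) \<le> sqrt (gns_square y) * sqrt (gns_square x)"
    by (rule power2_le_imp_le) (simp add: gns_square_nonneg)
qed

text \<open>The Riesz representation theorem for this inner product, without completing the space: a near
  minimizer \<open>y\<close> of \<open>f (v* v) - 2 Re \<psi> (v*)\<close> almost represents \<open>\<psi>\<close>.\<close>

lemma riesz_approximation:
  fixes \<psi> :: "'a cdual"
  assumes bd: "\<And>v. cmod (cdual_apply \<psi> (star v)) \<le> K * sqrt (gns_square v)" and \<epsilon>: "\<epsilon> > 0"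
  obtains y where "\<And>v. cmod (cdual_apply f (star v * y) - cdual_apply \<psi> (star v)) \<le> \<epsilon> * sqrt (gns_square v)"
proof -
  define J where "J v = gns_square v - 2 * Re (cdual_apply \<psi> (star v))" for v
  have J_low: "- K\<^sup>2 \<le> J v" for v
  proof -
    have "Re (cdual_apply \<psi> (star v)) \<le> K * sqrt (gns_square v)"
      using complex_Re_le_cmod bd order_trans by blast
    moreover have "0 \<le> (sqrt (gns_square v) - K)\<^sup>2" by simp
    ultimately show ?thesis using gns_square_nonneg[of v] by (simp add: J_def power2_diff algebra_simps)
  qed
  then have bdd: "bdd_below (range J)" by (intro bdd_belowI[of _ "- K\<^sup>2"]) auto
  have "Inf (range J) < Inf (range J) + \<epsilon>\<^sup>2" using \<epsilon> by simp
  then obtain y where y: "J y < Inf (range J) + \<epsilon>\<^sup>2"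
    using cInf_lessD[of "range J"] by blast
  have "Re (c * (cdual_apply f (star v * y) - cdual_apply \<psi> (star v))) \<le> \<epsilon> * sqrt (gns_square v)"
    if c: "cmod c = 1" for c v
  proof -
    define u where "u = cnj c *\<^sub>C v"
    have su: "gns_square u = gns_square v" using c by (simp add: u_def gns_square_scaleC)
    define D where "D = Re (cdual_apply f (star u * y) - cdual_apply \<psi> (star u))"
    have "0 \<le> \<epsilon>\<^sup>2 + 2 * s * D + s\<^sup>2 * gns_square u" for s
    proof -
      have "J (y + s *\<^sub>R u) = J y + 2 * s * D + s\<^sup>2 * gns_square u"
        by (simp add: J_def D_def gns_square_add star_simps cdual_apply_add cdual_apply_simps algebra_simps)
      moreover have "Inf (range J) \<le> J (y + s *\<^sub>R u)" by (rule cInf_lower[OF _ bdd]) simp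
      ultimately show ?thesis using y by linarith
    qed
    then have "D\<^sup>2 \<le> \<epsilon>\<^sup>2 * gns_square u" using gns_square_nonneg by (rule discriminant_nonpos)
    then have "D\<^sup>2 \<le> (\<epsilon> * sqrt (gns_square v))\<^sup>2" using gns_square_nonneg by (simp add: su power_mult_distrib)
    then have "D \<le> \<epsilon> * sqrt (gns_square v)"
      by (rule power2_le_imp_le) (use \<epsilon> gns_square_nonneg in simp)
    moreover have "D = Re (c * (cdual_apply f (star v * y) - cdual_apply \<psi> (star v)))"
      by (simp add: D_def u_def star_scaleC mult_scaleC_left cdual_apply_scaleC right_diff_distrib)
    ultimately show ?thesis by simp
  qed
  then show ?thesis using that cmod_le_of_rotations by blast
qed

text \<open>The vector functional \<open>\<psi> = bidual_act \<Theta> f\<close> is bounded for the seminorm of \<open>f\<close>, so it is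
  approximated in norm by \<open>right_act y f\<close>. On the latter \<open>\<Theta>*\<close> evaluates to the conjugate of
  \<open>\<psi> (y*)\<close>, which is close to \<open>f (y* y) \<ge> 0\<close>. This avoids constructing the universal
  representation or proving Arens regularity.\<close>

lemma bidual_square_nonneg: "0 \<le> Re (cdual_apply (bidual_star \<Theta> \<odot> \<Theta>) f)"
proof -
  define \<psi> where "\<psi> = bidual_act \<Theta> f"
  define val where "val = Re (cdual_apply (bidual_star \<Theta>) \<psi>)"
  have \<psi>_apply: "cdual_apply \<psi> x = cdual_apply \<Theta> (dual_act f x)" for x
    by (simp add: \<psi>_def bidual_act.rep_eq)
  have gns_square_le': "sqrt (gns_square v) \<le> sqrt (norm f) * norm v" for v
    using gns_square_le[of v] by (metis norm_ge_zero real_sqrt_abs abs_of_nonneg real_sqrt_le_iff real_sqrt_mult)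
  have bd: "cmod (cdual_apply \<psi> (star v)) \<le> norm \<Theta> * sqrt (norm f) * sqrt (gns_square v)" for v
  proof -
    have "norm (dual_act f (star v)) \<le> sqrt (norm f) * sqrt (gns_square v)"
    proof (rule norm_cdual_le)
      fix x
      have "cmod (cdual_apply f (star v * x)) \<le> sqrt (gns_square v) * sqrt (gns_square x)" by (rule cauchy_schwarz)
      also have "\<dots> \<le> sqrt (gns_square v) * (sqrt (norm f) * norm x)"
        using gns_square_nonneg by (intro mult_left_mono gns_square_le') simp
      finally show "cmod (cdual_apply (dual_act f (star v)) x) \<le> sqrt (norm f) * sqrt (gns_square v) * norm x"
        by (simp add: dual_act.rep_eq mult_ac)
    qed (simp add: gns_square_nonneg)
    then have "norm \<Theta> * norm (dual_act f (star v)) \<le> norm \<Theta> * (sqrt (norm f) * sqrt (gns_square v))"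
      by (intro mult_left_mono) simp_all
    then show ?thesis
      using cdual_apply_bound[of \<Theta> "dual_act f (star v)"] by (simp add: \<psi>_apply mult_ac)
  qed
  define C where "C = norm (bidual_star \<Theta>) * sqrt (norm f)"
  have C: "C \<ge> 0" by (simp add: C_def)
  have key: "0 \<le> val + (1 + C) * \<epsilon>" if \<epsilon>: "0 < \<epsilon>" "\<epsilon> \<le> 1" for \<epsilon>
  proof -
    obtain y where y: "\<And>v. cmod (cdual_apply f (star v * y) - cdual_apply \<psi> (star v)) \<le> \<epsilon> * sqrt (gns_square v)"
      using riesz_approximation[OF bd \<epsilon>(1)] by blast
    define \<rho> where "\<rho> = right_act y f"
    have "norm (\<rho> - \<psi>) \<le> \<epsilon> * sqrt (norm f)"
    proof (rule norm_cdual_le)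
      fix x
      have "cmod (cdual_apply (\<rho> - \<psi>) x) \<le> \<epsilon> * sqrt (gns_square (star x))"
        using y[of "star x"] by (simp add: \<rho>_def minus_cdual.rep_eq star_star)
      also have "\<dots> \<le> \<epsilon> * (sqrt (norm f) * norm x)"
        using gns_square_le'[of "star x"] \<epsilon> by (intro mult_left_mono) (simp_all add: norm_star)
      finally show "cmod (cdual_apply (\<rho> - \<psi>) x) \<le> \<epsilon> * sqrt (norm f) * norm x" by simp
    qed (use \<epsilon> in simp)
    then have "norm (bidual_star \<Theta>) * norm (\<rho> - \<psi>) \<le> C * \<epsilon>"
      using mult_left_mono[OF _ norm_ge_zero[of "bidual_star \<Theta>"]] by (fastforce simp: C_def mult_ac)
    then have "Re (cdual_apply (bidual_star \<Theta>) (\<rho> - \<psi>)) \<le> C * \<epsilon>"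
      using complex_Re_le_cmod cdual_apply_bound order_trans by metis
    moreover have "dual_star \<rho> = dual_act f (star y)"
      by (simp add: \<rho>_def cdual_apply_inject[symmetric] fun_eq_iff dual_act.rep_eq dual_star.rep_eq
          positive_functional_star[symmetric] star_simps)
    then have "Re (cdual_apply (bidual_star \<Theta>) \<rho>) = Re (cdual_apply \<psi> (star y))"
      by (simp add: bidual_star.rep_eq \<psi>_apply)
    ultimately have 1: "Re (cdual_apply \<psi> (star y)) \<le> val + C * \<epsilon>"
      by (simp add: val_def cdual_apply_simps)
    have "gns_square y - Re (cdual_apply \<psi> (star y)) \<le> \<epsilon> * sqrt (gns_square y)"
      using order_trans[OF complex_Re_le_cmod y[of y]] by (simp add: gns_square_def)
    moreover have "0 \<le> (sqrt (gns_square y) - \<epsilon>)\<^sup>2 + \<epsilon> * sqrt (gns_square y)" using \<epsilon> gns_square_nonneg by simp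
    then have "\<epsilon> * sqrt (gns_square y) - gns_square y \<le> \<epsilon>\<^sup>2" using gns_square_nonneg[of y] by (simp add: power2_diff)
    moreover have "\<epsilon>\<^sup>2 \<le> \<epsilon>" using \<epsilon> by (simp add: power2_eq_square mult_left_le)
    ultimately have "- \<epsilon> \<le> Re (cdual_apply \<psi> (star y))" by linarith
    with 1 show ?thesis by (simp add: distrib_right)
  qed
  have "0 \<le> val"
  proof (rule ccontr)
    assume "\<not> 0 \<le> val"
    define \<epsilon> where "\<epsilon> = min 1 (- val / (2 * (1 + C)))"
    have "(1 + C) * \<epsilon> \<le> (1 + C) * (- val / (2 * (1 + C)))"
      using C by (intro mult_left_mono) (simp_all add: \<epsilon>_def)
    also have "\<dots> = - val / 2" using C by (simp add: field_simps)
    finally have "(1 + C) * \<epsilon> \<le> - val / 2" .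
    moreover have "0 < \<epsilon>" using C \<open>\<not> 0 \<le> val\<close> by (auto simp: \<epsilon>_def not_le intro!: divide_neg_pos)
    then have "0 \<le> val + (1 + C) * \<epsilon>" by (rule key) (simp add: \<epsilon>_def)
    ultimately show False using \<open>\<not> 0 \<le> val\<close> by linarith
  qed
  then show ?thesis by (simp add: val_def arens.rep_eq \<psi>_def)
qed

end

section \<open>Peak projections\<close>

lemma weak_star_limit_apply:
  assumes "limitin weak_star_topology F u sequentially"
  shows "(\<lambda>n. cdual_apply (F n) f) \<longlonglongrightarrow> cdual_apply u f"
proof -
  have "continuous_map weak_star_topology euclidean ((\<lambda>x. x f) \<circ> cdual_apply)"
    unfolding weak_star_topology_def
    by (intro continuous_map_pullback continuous_map_product_projection) simp
  from continuous_map_limit[OF this assms] show ?thesis by (simp add: o_def)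
qed

locale peak_projection =
  fixes a :: "'b :: cstar_algebra" and q :: "'b bidual"
  assumes peaks: "peaks_at a q"
begin

lemma peak_lim: "(\<lambda>n. cdual_apply f (a * (star a * a) ^ n)) \<longlonglongrightarrow> cdual_apply q f"
proof -
  have "limitin weak_star_topology (\<lambda>n. bidual_embed (a * (star a * a) ^ n)) q sequentially"
    using peaks by (simp add: peaks_at_def peak_limit_def)
  from weak_star_limit_apply[OF this, of f] show ?thesis by (simp add: bidual_embed.rep_eq)
qed

lemma peak_star: "cdual_apply q (dual_star f) = cnj (cdual_apply q f)"
proof -
  have "bidual_star q = q" using peaks by (simp add: peaks_at_def bidual_projection_def)
  then have "cdual_apply q f = cnj (cdual_apply q (dual_star f))"
    by (metis bidual_star.rep_eq)
  then show ?thesis by simp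
qed

lemma dual_star_dual_star: "dual_star (dual_star g) = g"
  by (simp add: cdual_apply_inject[symmetric] fun_eq_iff dual_star.rep_eq star_star)

text \<open>For the self-adjoint \<open>q\<close>, the identities \<open>y* q = q\<close> and \<open>q y = q\<close> are adjoint to each
  other; both are expressed through translates of functionals.\<close>

lemma absorbs_star_iff:
  "(\<forall>f. cdual_apply q (dual_act f (star y)) = cdual_apply q f) \<longleftrightarrow>
   (\<forall>f. cdual_apply q (right_act y f) = cdual_apply q f)"
  unfolding dual_act_star peak_star by (metis complex_cnj_cnj dual_star_dual_star peak_star)

lemma absorbs_power:
  assumes "\<And>f. cdual_apply q (dual_act f w) = cdual_apply q f"
  shows "cdual_apply q (dual_act f (w ^ n)) = cdual_apply q f"
  by (induction n arbitrary: f) (simp_all add: dual_act_one dual_act_mult assms)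

text \<open>In terms of products, \<open>a q = q = a* q\<close>. Shifting the index in \<open>q = lim a (a* a)^n\<close> gives
  \<open>q a* a = q\<close>, hence \<open>a* a q = q\<close>. Multiplying the limit by \<open>q\<close> then gives \<open>q = q q = a q\<close>, so
  \<open>q a* = q\<close> and \<open>q a = q a* a = q\<close>, and the adjoint of this is \<open>a* q = q\<close>.\<close>

lemma peak_absorbs:
  shows "cdual_apply q (dual_act f a) = cdual_apply q f"
    and "cdual_apply q (dual_act f (star a)) = cdual_apply q f"
proof -
  have sh: "a * (star a * a) ^ n * (star a * a) = a * (star a * a) ^ Suc n" for n
    by (simp only: power_Suc2 mult.assoc)
  have R: "cdual_apply q (right_act (star a * a) f) = cdual_apply q f" for f
  proof -
    have "(\<lambda>n. cdual_apply f (a * (star a * a) ^ Suc n)) \<longlonglongrightarrow> cdual_apply q (right_act (star a * a) f)"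
      using peak_lim[of "right_act (star a * a) f"] by (simp only: right_act_apply sh)
    moreover have "(\<lambda>n. cdual_apply f (a * (star a * a) ^ Suc n)) \<longlonglongrightarrow> cdual_apply q f"
      using peak_lim[of f] by (rule LIMSEQ_Suc)
    ultimately show ?thesis by (rule LIMSEQ_unique)
  qed
  have "star (star a * a) = star a * a" by (simp add: star_simps)
  then have L: "cdual_apply q (dual_act f (star a * a)) = cdual_apply q f" for f
    using absorbs_star_iff[of "star a * a"] R by simp
  have Ln: "cdual_apply q (dual_act f ((star a * a) ^ n)) = cdual_apply q f" for f n
    using L by (rule absorbs_power)
  have 1: "cdual_apply q (dual_act f a) = cdual_apply q f" for f
  proof -
    have "q \<odot> q = q" using peaks by (simp add: peaks_at_def bidual_projection_def)
    then have "cdual_apply q f = cdual_apply q (bidual_act q f)" by (metis arens.rep_eq)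
    moreover have "(\<lambda>n. cdual_apply q (dual_act f a)) \<longlonglongrightarrow> cdual_apply q (bidual_act q f)"
      using peak_lim[of "bidual_act q f"] by (simp add: bidual_act.rep_eq dual_act_mult[of _ a] Ln)
    ultimately show ?thesis by (simp add: LIMSEQ_const_iff)
  qed
  then show "cdual_apply q (dual_act f a) = cdual_apply q f" .
  have "\<forall>f. cdual_apply q (right_act (star a) f) = cdual_apply q f"
    using absorbs_star_iff[of "star a"] 1 by (simp add: star_star)
  then have "cdual_apply q (right_act a f) = cdual_apply q (right_act (star a) (right_act a f))" for f
    by simp
  moreover have "right_act (star a) (right_act a f) = right_act (star a * a) f" for f
    by (simp add: cdual_apply_inject[symmetric] fun_eq_iff mult.assoc)
  ultimately have "\<forall>f. cdual_apply q (right_act a f) = cdual_apply q f" using R by simp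
  then show "cdual_apply q (dual_act f (star a)) = cdual_apply q f"
    using absorbs_star_iff[of a] by simp
qed

lemma peak_lim_modulus: "(\<lambda>n. cdual_apply f ((star a * a) ^ n)) \<longlonglongrightarrow> cdual_apply q f"
proof -
  have "(\<lambda>n. cdual_apply f ((star a * a) ^ Suc n)) \<longlonglongrightarrow> cdual_apply q (dual_act f (star a))"
    using peak_lim[of "dual_act f (star a)"] by (simp add: dual_act.rep_eq mult.assoc)
  then show ?thesis unfolding peak_absorbs by (rule LIMSEQ_imp_Suc)
qed

text \<open>Because \<open>y\<close> commutes with the \<open>(a* a)^n\<close>, it commutes with their limit \<open>q\<close>, and
  \<open>q y q = y q\<close> is the limit of \<open>y (a* a)^n\<close>.\<close>

lemma peak_compression_lim:
  assumes y: "y * (star a * a) = star a * a * y"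
  shows "(\<lambda>n. cdual_apply f (y * (star a * a) ^ n)) \<longlonglongrightarrow> cdual_apply (q \<odot> bidual_embed y \<odot> q) f"
proof -
  have yn: "y * (star a * a) ^ n = (star a * a) ^ n * y" for n
    using y by (rule commute_power)
  have absorb: "cdual_apply q (dual_act f ((star a * a) ^ n)) = cdual_apply q f" for f n
    by (rule absorbs_power) (simp only: dual_act_mult peak_absorbs)
  have "cdual_apply (bidual_act q f) ((star a * a) ^ n * y) = cdual_apply q (dual_act f y)" for n
    by (simp add: bidual_act.rep_eq yn[symmetric] dual_act_mult[of _ y] absorb)
  then have "(\<lambda>n. cdual_apply q (dual_act f y)) \<longlonglongrightarrow> cdual_apply (q \<odot> bidual_embed y \<odot> q) f"
    using peak_lim_modulus[of "right_act y (bidual_act q f)"] by (simp add: arens.rep_eq)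
  then have "cdual_apply q (dual_act f y) = cdual_apply (q \<odot> bidual_embed y \<odot> q) f"
    by (simp add: LIMSEQ_const_iff)
  then show ?thesis using peak_lim_modulus[of "dual_act f y"] by (simp add: dual_act.rep_eq)
qed

end

text \<open>The positive part \<open>p\<close> of \<open>c - 1\<close> vanishes on the peak, in the quantitative form that
  \<open>p\<^sup>3 (a* a)^k\<close> tends to 0 in norm. These elements decrease, so otherwise a positive functional
  \<open>f\<close> stays above \<open>\<delta>\<close> on all of them. Evaluate the hypothesis \<open>q y q \<le> q d q\<close> at
  \<open>g = f (p r _ r p)\<close>: as \<open>r d r = 1\<close> and \<open>r y r = c\<close>, the difference of the two sides is the limit of
  \<open>f (p (1 - c) p (a* a)^k) = - f (p\<^sup>3 (a* a)^k) \<le> - \<delta>\<close>, a contradiction. The cube arises as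
  \<open>p (c - 1) p = p\<^sup>3\<close>, since the negative part is orthogonal to \<open>p\<close>.\<close>

lemma (in peak_projection) peak_compressed_to_zero:
  fixes c p n :: 'b
  assumes contr: "norm a \<le> 1"
    and p: "nonneg_elt p" and split: "c - 1 = p - n" "p * n = 0"
    and pa: "p * (star a * a) = star a * a * p"
    and r: "star r = r" "r * d * r = 1" "r * y * r = c"
    and ra: "r * (star a * a) = star a * a * r"
    and da: "d * (star a * a) = star a * a * d" and ya: "y * (star a * a) = star a * a * y"
    and le: "q \<odot> bidual_embed y \<odot> q \<preceq>\<^sub>*\<^sub>* q \<odot> bidual_embed d \<odot> q"
    and \<delta>: "0 < \<delta>"
  obtains k where "norm (p * p * p * (star a * a) ^ k) < \<delta>"
proof (rule ccontr)
  assume "\<not> thesis"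
  define m where "m k = (star a * a) ^ k" for k
  have low: "\<delta> \<le> norm (p * p * p * m k)" for k
    using \<open>\<not> thesis\<close> that[of k] by (force simp: m_def)
  have commm: "x * m k = m k * x" if "x * (star a * a) = star a * a * x" for x k
    unfolding m_def using that by (rule commute_power)
  have m_nonneg: "nonneg_elt (m k)" for k
  proof (induction k)
    case (Suc k)
    have "nonneg_elt (star a * a * m k)"
      using commm[of "star a * a" k] by (intro nonneg_elt_mult[OF nonneg_elt_star_mult_self Suc]) simp
    then show ?case by (simp add: m_def)
  qed (simp add: m_def)
  have "norm (star a * a) \<le> 1" using contr by (simp add: norm_star_mult_self power_le_one)
  then have m_norm: "norm (m k) \<le> 1" for k
    unfolding m_def by (meson norm_ge_zero norm_power_ineq order_trans power_le_one)
  note sp = nonneg_elt_star[OF p]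
  have p3: "nonneg_elt (p * (p * p))"
    by (rule nonneg_elt_mult[OF p nonneg_elt_square[OF sp]]) (simp add: mult.assoc)
  have p3m: "p * (p * p) * m k = m k * (p * (p * p))" for k
    using commm[OF pa, of k] by (metis mult.assoc)
  have "nonneg_elt (p * (p * p) * m k)" for k
    by (rule nonneg_elt_mult[OF p3 m_nonneg p3m])
  moreover have "nonneg_elt (p * (p * p) * m i - p * (p * p) * m k)" if "i \<le> k" for i k
  proof -
    have mm: "m k = m i * m (k - i)" using that by (simp add: m_def flip: power_add)
    have "nonneg_elt (1 *\<^sub>R 1 - m (k - i))"
      using m_nonneg m_norm by (intro nonneg_elt_sub_norm nonneg_elt_star)
    moreover have "m i * m (k - i) = m (k - i) * m i" by (simp add: m_def add.commute flip: power_add)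
    ultimately have "nonneg_elt (m i * (1 - m (k - i)))"
      by (intro nonneg_elt_mult m_nonneg) (simp_all add: algebra_simps)
    moreover have "p * (p * p) * (m i * (1 - m (k - i))) = m i * (1 - m (k - i)) * (p * (p * p))"
      unfolding right_diff_distrib mm[symmetric] mult_1_right left_diff_distrib p3m ..
    ultimately have "nonneg_elt (p * (p * p) * (m i * (1 - m (k - i))))"
      by (rule nonneg_elt_mult[OF p3])
    then show ?thesis by (simp add: mm algebra_simps)
  qed
  moreover have "\<delta> \<le> norm (p * (p * p) * m k)" for k using low[of k] by (simp add: mult.assoc)
  ultimately obtain f where f: "positive_functional f" "\<And>k. \<delta> \<le> Re (cdual_apply f (p * (p * p) * m k))"
    using positive_functional_above[of "\<lambda>k. p * (p * p) * m k" \<delta>] by blast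
  define g where "g = right_act (r * p) (dual_act f (p * r))"
  have g_apply: "cdual_apply g x = cdual_apply f (p * r * x * (r * p))" for x
    by (simp add: g_def dual_act.rep_eq mult.assoc)
  have "positive_functional g" unfolding positive_functional_def g_apply
  proof (intro allI impI)
    fix x :: 'b assume "nonneg_elt x"
    from nonneg_elt_conj[OF this, of "r * p"] have "nonneg_elt (p * r * x * (r * p))"
      by (simp add: star_mult r(1) sp mult.assoc)
    then show "Im (cdual_apply f (p * r * x * (r * p))) = 0 \<and> 0 \<le> Re (cdual_apply f (p * r * x * (r * p)))"
      using f(1) by (simp add: positive_functional_def)
  qed
  moreover obtain \<Theta> where \<Theta>: "q \<odot> bidual_embed d \<odot> q - q \<odot> bidual_embed y \<odot> q = bidual_star \<Theta> \<odot> \<Theta>"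
    using le by (auto simp: bidual_le_def bidual_positive_def)
  ultimately have "0 \<le> Re (cdual_apply (q \<odot> bidual_embed d \<odot> q - q \<odot> bidual_embed y \<odot> q) g)"
    using bidual_square_nonneg by metis
  moreover have "(\<lambda>k. Re (cdual_apply g (d * m k) - cdual_apply g (y * m k)))
      \<longlonglongrightarrow> Re (cdual_apply (q \<odot> bidual_embed d \<odot> q - q \<odot> bidual_embed y \<odot> q) g)"
    unfolding minus_cdual.rep_eq m_def
    by (intro tendsto_intros peak_compression_lim da ya)
  moreover have "Re (cdual_apply g (d * m k) - cdual_apply g (y * m k)) \<le> - \<delta>" for k
  proof -
    have e: "p * r * (x * m k) * (r * p) = p * (r * x * r) * p * m k" for x
    proof -
      have "m k * (r * u) = r * (m k * u)" for u
        using commm[OF ra, of k] by (simp flip: mult.assoc)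
      then show ?thesis by (simp add: mult.assoc commm[OF pa])
    qed
    have "p * r * (d * m k) * (r * p) - p * r * (y * m k) * (r * p) = - (p * (c - 1) * p * m k)"
      unfolding e r(2,3) by (simp add: algebra_simps)
    also have "\<dots> = - (p * (p * p) * m k)"
      unfolding split(1) using split(2) by (simp add: right_diff_distrib mult.assoc)
    finally have "cdual_apply g (d * m k) - cdual_apply g (y * m k) = - cdual_apply f (p * (p * p) * m k)"
      unfolding g_apply by (metis cdual_apply_simps(2,3))
    then show ?thesis using f(2)[of k] by simp
  qed
  ultimately have "Re (cdual_apply (q \<odot> bidual_embed d \<odot> q - q \<odot> bidual_embed y \<odot> q) g) \<le> - \<delta>"
    by (intro LIMSEQ_le_const2) auto
  with \<open>0 \<le> Re _\<close> \<delta> show False by simp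
qed

section \<open>The interpolation theorem\<close>

text \<open>From the cube to the square: \<open>\<parallel>p\<^sup>2 w\<parallel>\<^sup>2 = \<parallel>p\<^sup>4 w\<^sup>2\<parallel> \<le> \<parallel>p\<parallel> \<parallel>p\<^sup>3 w\<parallel>\<close> for
  \<open>w = (a* a)^k\<close>; then pass from \<open>w\<close> to a Cesaro mean.\<close>

lemma small_cesaro:
  fixes a p :: "'a :: cstar_algebra"
  assumes a: "norm a \<le> 1" and p: "nonneg_elt p" and pa: "p * (star a * a) = star a * a * p"
    and decay: "\<And>\<delta>. \<delta> > 0 \<Longrightarrow> \<exists>k. norm (p * p * p * (star a * a) ^ k) < \<delta>"
    and e: "e > 0"
  obtains m where "m > 0" "norm (p * p * cesaro a m) \<le> e"
proof -
  define \<delta> where "\<delta> = (e / 2)\<^sup>2 / (1 + norm p)"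
  have d1: "1 + norm p > 0" by (simp add: add_pos_nonneg)
  then have "\<delta> > 0" using e by (simp add: \<delta>_def)
  then obtain k where k: "norm (p * p * p * (star a * a) ^ k) < \<delta>" using decay by blast
  define w where "w = (star a * a) ^ k"
  have pw: "p * w = w * p"
    unfolding w_def using pa by (rule commute_power)
  have sw: "star w = w" by (simp add: w_def star_power star_simps)
  have nw: "norm w \<le> 1"
  proof -
    have "norm (star a * a) \<le> 1" using a by (simp add: norm_star_mult_self power_le_one)
    then show ?thesis unfolding w_def by (meson norm_ge_zero norm_power_ineq order_trans power_le_one)
  qed
  have "star (p * p * w) * (p * p * w) = p * (p * p * p * w) * w"
  proof -
    have "w * (p * u) = p * (w * u)" for u using pw by (simp flip: mult.assoc)
    then show ?thesis by (simp add: star_mult sw nonneg_elt_star[OF p] mult.assoc)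
  qed
  then have "(norm (p * p * w))\<^sup>2 = norm (p * (p * p * p * w) * w)"
    by (metis norm_star_mult_self)
  also have "\<dots> \<le> norm (p * (p * p * p * w)) * norm w" by (rule norm_mult_ineq)
  also have "\<dots> \<le> norm p * norm (p * p * p * w) * 1"
    using nw by (intro mult_mono norm_mult_ineq) simp_all
  also have "\<dots> \<le> (1 + norm p) * \<delta>"
    using k by (simp add: w_def) (intro mult_mono; simp)
  also have "\<dots> = (e / 2)\<^sup>2" using d1 by (simp add: \<delta>_def)
  finally have "norm (p * p * w) \<le> e / 2" by (rule power2_le_imp_le) (use e in simp)
  moreover obtain m where m: "m > 0" "norm (p * p) * norm (w * cesaro a m - cesaro a m) \<le> e / 2"
  proof -
    have "(\<lambda>m. norm (p * p) * norm (w * cesaro a m - cesaro a m)) \<longlonglongrightarrow> norm (p * p) * norm (0 :: 'a)"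
      unfolding w_def by (intro tendsto_intros cesaro_asymptotically_fixed a)
    then have "\<forall>\<^sub>F m in sequentially. norm (p * p) * norm (w * cesaro a m - cesaro a m) < e / 2"
      by (rule order_tendstoD) (use e in simp)
    then have "\<forall>\<^sub>F m in sequentially. m > 0 \<and> norm (p * p) * norm (w * cesaro a m - cesaro a m) < e / 2"
      using eventually_gt_at_top[of 0] by eventually_elim simp
    from eventually_happens[OF this]
    obtain m where "m > 0 \<and> norm (p * p) * norm (w * cesaro a m - cesaro a m) < e / 2" by auto
    then show ?thesis using that[of m] by simp
  qed
  moreover have "p * p * cesaro a m = p * p * w * cesaro a m - p * p * (w * cesaro a m - cesaro a m)"
    by (simp add: algebra_simps)
  then have "norm (p * p * cesaro a m) \<le> norm (p * p * w * cesaro a m) + norm (p * p * (w * cesaro a m - cesaro a m))"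
    using norm_triangle_ineq4 by metis
  moreover have "norm (p * p * w * cesaro a m) \<le> norm (p * p * w) * 1"
    using norm_mult_ineq[of "p * p * w" "cesaro a m"] mult_left_mono[OF norm_cesaro[OF a, of m] norm_ge_zero]
    by (rule order_trans)
  moreover have "norm (p * p * (w * cesaro a m - cesaro a m)) \<le> norm (p * p) * norm (w * cesaro a m - cesaro a m)"
    by (rule norm_mult_ineq)
  ultimately show ?thesis using that[of m] by simp
qed

theorem corollary5p4:
  fixes A :: "'b :: cstar_algebra set" and a b d :: 'b and q :: "'b bidual"
  assumes "operator_algebra A"
    and "bidual_projection q" and "q \<in> bidual_of (unitization A)"
    and "a \<in> unitization A" and "norm a \<le> 1" and "peaks_at a q"
    and "b \<in> A" and "cstar_abs b * a = a * cstar_abs b"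
    and "cstar_positive d" and "\<exists>e. d * e = 1 \<and> e * d = 1" and "d * a = a * d"
    and "q \<odot> bidual_embed (star b * b) \<odot> q \<preceq>\<^sub>*\<^sub>* q \<odot> bidual_embed d \<odot> q"
  shows "\<exists>x\<in>A. star x * x \<preceq> d \<and> bidual_embed x \<odot> q = bidual_embed b \<odot> q"
proof -
  interpret peak_projection a q by unfold_locales (rule assms(6))
  note A = assms(1)[unfolded operator_algebra_def]
  have d: "nonneg_elt d" using assms(9) by (simp add: cstar_positive_iff_nonneg_elt)
  have comm_aa: "y * (star a * a) = star a * a * y" if "star y = y" "y * a = a * y" for y
    using star_commute[OF that] that(2) by (metis mult.assoc)
  have ba: "star b * b * a = a * (star b * b)"
    using assms(8) cstar_abs_properties(2)[of b] by (metis mult.assoc)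
  obtain e where e: "d * e = 1" "e * d = 1" using assms(10) by blast
  obtain s where s: "nonneg_elt s" "s * s = d" "\<And>y. y * d = d * y \<Longrightarrow> y * s = s * y"
    using nonneg_elt_sqrt[OF d] by blast
  note ss = nonneg_elt_star[OF s(1)]
  have sa: "a * s = s * a" by (rule s(3)) (rule assms(11)[symmetric])
  have es: "e * s = s * e" by (rule s(3)) (simp add: e)
  define r where "r = s * e"
  have sr: "s * r = 1" unfolding r_def using e s(2) by (simp flip: mult.assoc)
  have rs: "r * s = 1" unfolding r_def using e s(2) es by (metis mult.assoc)
  have "star r * s = 1" using sr ss by (metis star_mult star_one)
  then have r_star: "star r = r" using sr by (metis mult.assoc mult_1_left mult_1_right)
  have ra: "r * a = a * r"
  proof -
    have "r * a = r * (a * s) * r" by (simp add: mult.assoc sr)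
    also have "\<dots> = r * s * (a * r)" by (simp only: sa mult.assoc)
    finally show ?thesis by (simp add: rs)
  qed
  have "r * d * r = (r * s) * (s * r)" by (simp only: s(2)[symmetric] mult.assoc)
  then have rdr: "r * d * r = 1" by (simp add: rs sr)
  define c where "c = r * (star b * b) * r"
  have "c = star (b * r) * (b * r)" by (simp add: c_def star_mult r_star mult.assoc)
  then have c: "nonneg_elt c" by (simp only: nonneg_elt_star_mult_self)
  have ca: "c * a = a * c" unfolding c_def using ra ba by (metis mult.assoc)
  have "star (c - 1) = c - 1" using c by (simp add: star_simps nonneg_elt_star)
  then obtain p n where pn: "nonneg_elt p" "nonneg_elt n" "c - 1 = p - n" "p * n = 0" "n * p = 0"
    "\<And>y. y * (c - 1) = (c - 1) * y \<Longrightarrow> y * p = p * y"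
    "\<And>y. y * (c - 1) = (c - 1) * y \<Longrightarrow> y * n = n * y"
    using jordan_decomposition by blast
  have c1: "y * (c - 1) = (c - 1) * y" if "y * c = c * y" for y using that by (simp add: algebra_simps)
  have pa: "p * a = a * p" using pn(6)[OF c1, OF ca[symmetric]] by simp
  note paa = comm_aa[OF nonneg_elt_star[OF pn(1)] pa]
  \<comment> \<open>The conditions describe the contractions that inherit what is needed of \<open>a\<close>: they multiply
    \<open>A\<close> into itself, commute with the commutant of \<open>a\<close>, and fix \<open>q\<close>. All of them survive products,
    convex combinations and limits.\<close>
  define S where "S = {g. norm g \<le> 1 \<and> (\<forall>x\<in>A. x * g \<in> A) \<and> (\<forall>y. y * a = a * y \<longrightarrow> y * g = g * y)
    \<and> (\<forall>f. cdual_apply q (dual_act f g) = cdual_apply q f)}"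
  have SI: "g \<in> S" if "norm g \<le> 1" "\<And>x. x \<in> A \<Longrightarrow> x * g \<in> A"
    "\<And>y. y * a = a * y \<Longrightarrow> y * g = g * y" "\<And>f. cdual_apply q (dual_act f g) = cdual_apply q f" for g
    unfolding S_def using that by blast
  have S_norm: "norm g \<le> 1" and S_right: "\<And>x. x \<in> A \<Longrightarrow> x * g \<in> A"
    and S_comm: "\<And>y. y * a = a * y \<Longrightarrow> y * g = g * y"
    and S_absorb: "\<And>f. cdual_apply q (dual_act f g) = cdual_apply q f" if "g \<in> S" for g
    using that unfolding S_def by blast+
  have act_apply: "cdual_apply q (dual_act f x) = cdual_apply (bidual_act q f) x" for f x
    by (simp add: bidual_act.rep_eq)
  have S1: "1 \<in> S"
    by (rule SI) (simp_all add: dual_act_one)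
  have Sm: "g * h \<in> S" if g: "g \<in> S" and h: "h \<in> S" for g h
  proof (rule SI)
    have "norm (g * h) \<le> 1 * 1"
      by (intro order_trans[OF norm_mult_ineq mult_mono] S_norm g h) simp_all
    then show "norm (g * h) \<le> 1" by simp
    show "x * (g * h) \<in> A" if "x \<in> A" for x
      using S_right[OF h S_right[OF g that]] by (simp add: mult.assoc)
    show "y * (g * h) = g * h * y" if "y * a = a * y" for y
      using S_comm[OF g that] S_comm[OF h that] by (metis mult.assoc)
    show "cdual_apply q (dual_act f (g * h)) = cdual_apply q f" for f
      by (simp add: dual_act_mult S_absorb g h)
  qed
  have aS: "a \<in> S"
  proof (rule SI)
    show "norm a \<le> 1" by (rule assms(5))
    show "cdual_apply q (dual_act f a) = cdual_apply q f" for f by (rule peak_absorbs(1))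
    obtain y \<mu> where "y \<in> A" "a = y + \<mu> *\<^sub>C 1" using assms(4) by (auto simp: unitization_def)
    then show "x * a \<in> A" if "x \<in> A" for x
      using A that by (simp add: distrib_left mult_scaleC_right)
  qed
  then have aS': "a ^ k \<in> S" for k by (induction k) (simp_all add: S1 Sm)
  have Scl: "closed S"
    unfolding closed_sequential_limits
  proof (intro allI impI, elim conjE)
    fix g l assume "\<forall>n. g n \<in> S" and l: "g \<longlonglongrightarrow> l"
    then have g: "g n \<in> S" for n by simp
    show "l \<in> S"
    proof (rule SI)
      show "norm l \<le> 1"
        using LIMSEQ_le_const2[OF tendsto_norm[OF l]] S_norm[OF g] by blast
      show "x * l \<in> A" if "x \<in> A" for x
      proof (rule closed_sequentially[of A "\<lambda>n. x * g n"])
        show "closed A" using A by blast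
        show "x * g n \<in> A" for n by (rule S_right[OF g that])
        show "(\<lambda>n. x * g n) \<longlonglongrightarrow> x * l" by (intro tendsto_intros l)
      qed
      show "y * l = l * y" if "y * a = a * y" for y
      proof (rule LIMSEQ_unique)
        show "(\<lambda>n. y * g n) \<longlonglongrightarrow> y * l" by (intro tendsto_intros l)
        have "(\<lambda>n. g n * y) \<longlonglongrightarrow> l * y" by (intro tendsto_intros l)
        then show "(\<lambda>n. y * g n) \<longlonglongrightarrow> l * y" by (simp only: S_comm[OF g that])
      qed
      show "cdual_apply q (dual_act f l) = cdual_apply q f" for f
      proof (rule LIMSEQ_unique)
        show "(\<lambda>n. cdual_apply (bidual_act q f) (g n)) \<longlonglongrightarrow> cdual_apply q (dual_act f l)"
          unfolding act_apply
          by (rule bounded_linear.tendsto[OF bounded_linear_cdual_apply l])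
        show "(\<lambda>n. cdual_apply (bidual_act q f) (g n)) \<longlonglongrightarrow> cdual_apply q f"
          by (simp add: bidual_act.rep_eq S_absorb[OF g])
      qed
    qed
  qed
  have A_scaleR: "u *\<^sub>R x \<in> A" if "x \<in> A" for u :: real and x
    using A that by (simp add: scaleR_scaleC)
  have Scv: "convex S" unfolding convex_alt
  proof (intro ballI allI impI, elim conjE)
    fix g h and t :: real assume g: "g \<in> S" and h: "h \<in> S" and t: "0 \<le> t" "t \<le> 1"
    show "(1 - t) *\<^sub>R g + t *\<^sub>R h \<in> S"
    proof (rule SI)
      have "norm ((1 - t) *\<^sub>R g + t *\<^sub>R h) \<le> (1 - t) * norm g + t * norm h"
        using norm_triangle_ineq[of "(1 - t) *\<^sub>R g" "t *\<^sub>R h"] t by simp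
      also have "\<dots> \<le> (1 - t) * 1 + t * 1"
        using t by (intro add_mono mult_left_mono S_norm g h) auto
      finally show "norm ((1 - t) *\<^sub>R g + t *\<^sub>R h) \<le> 1" by simp
      show "x * ((1 - t) *\<^sub>R g + t *\<^sub>R h) \<in> A" if "x \<in> A" for x
        using A A_scaleR S_right[OF g that] S_right[OF h that] by (simp add: distrib_left)
      show "y * ((1 - t) *\<^sub>R g + t *\<^sub>R h) = ((1 - t) *\<^sub>R g + t *\<^sub>R h) * y" if "y * a = a * y" for y
        by (simp add: distrib_left distrib_right S_comm[OF g that] S_comm[OF h that])
      show "cdual_apply q (dual_act f ((1 - t) *\<^sub>R g + t *\<^sub>R h)) = cdual_apply q f" for f
        unfolding act_apply cdual_apply_add cdual_apply_simps
        by (simp add: bidual_act.rep_eq S_absorb g h algebra_simps)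
    qed
  qed
  interpret contraction_semigroup S c p n
  proof
    show "c * g = g * c" if "g \<in> S" for g by (rule S_comm[OF that ca])
    show "\<exists>k\<in>S. norm (p * p * k) \<le> \<epsilon>" if "\<epsilon> > 0" for \<epsilon>
    proof -
      have "\<exists>k. norm (p * p * p * (star a * a) ^ k) < \<delta>" if "\<delta> > 0" for \<delta>
        using peak_compressed_to_zero[OF assms(5) pn(1,3,4) paa r_star rdr c_def[symmetric]
            comm_aa[OF r_star ra] comm_aa[OF nonneg_elt_star[OF d] assms(11)] comm_aa[OF _ ba] assms(12) that]
        by (metis star_mult star_star)
      then obtain m where "m > 0" "norm (p * p * cesaro a m) \<le> \<epsilon>"
        using small_cesaro[OF assms(5) pn(1) paa _ \<open>\<epsilon> > 0\<close>] by blast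
      then show ?thesis using cesaro_mem[OF Scv _ aS'] by blast
    qed
    show "y * p = p * y" "y * n = n * y" if "y * c = c * y" for y
      using pn(6,7)[OF c1[OF that]] by auto
  qed (fact S_norm Sm Scv Scl S1 c pn(1-3))+
  obtain g where g: "g \<in> S" "nonneg_elt (1 - star g * c * g)" by (rule exact_interpolation)
  have sg: "s * g = g * s" by (rule S_comm[OF g(1) sa[symmetric]])
  have sg': "s * star g = star g * s" using star_commute[OF ss sg] .
  \<comment> \<open>With \<open>b* b = s c s\<close> and \<open>d = s\<^sup>2\<close>, conjugating \<open>g* c g \<le> 1\<close> by \<open>s\<close> gives the inequality for
    \<open>x = b g\<close>.\<close>
  have bb: "star b * b = s * c * s"
  proof -
    have "s * c * s = (s * r) * (star b * b) * (r * s)" by (simp only: c_def mult.assoc)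
    then show ?thesis by (simp add: rs sr)
  qed
  have "star (b * g) * (b * g) = star g * (star b * b) * g" by (simp add: star_mult mult.assoc)
  also have "\<dots> = (star g * s) * c * (s * g)" unfolding bb by (simp only: mult.assoc)
  also have "\<dots> = s * (star g * c * g) * s" unfolding sg sg'[symmetric] by (simp only: mult.assoc)
  finally have "d - star (b * g) * (b * g) = star s * (1 - star g * c * g) * s"
    by (simp add: ss algebra_simps s(2))
  then have "star (b * g) * (b * g) \<preceq> d"
    unfolding cstar_le_def cstar_positive_iff_nonneg_elt using nonneg_elt_conj[OF g(2), of s] by simp
  moreover have "b * g \<in> A" by (rule S_right[OF g(1) assms(7)])
  moreover have "bidual_embed (b * g) \<odot> q = bidual_embed b \<odot> q"
    using S_absorb[OF g(1)] by (simp add: cdual_apply_inject[symmetric] fun_eq_iff arens.rep_eq bidual_embed.rep_eq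
        bidual_act.rep_eq dual_act_mult)
  ultimately show ?thesis by blast
qed

end
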